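(* The set $\mathscr S$ of standard words is a basis of $\mathcal H^+$ as a $\mathbb K'$-vector space.
   Context: Let $\mathbb K'=\mathbb Q(h,q)$. In this normalization the stable limit DAHA $\mathcal H^+$ is the $\mathbb K'$-algebra generated by $\mathbf T_i,\mathbf X_i,\mathbf Y_i$, $i\ge1$, with relations: $\mathbf T_i\mathbf T_j=\mathbf T_j\mathbf T_i$ for $|i-j|>1$; $\mathbf T_i\mathbf T_{i+1}\mathbf T_i=\mathbf T_{i+1}\mathbf T_i\mathbf T_{i+1}$; $\mathbf T_i-\mathbf T_i^{-1}=h$; $\mathbf T_i^{-1}\mathbf X_i\mathbf T_i^{-1}=\mathbf X_{i+1}$; $\mathbf T_i\mathbf X_j=\mathbf X_j\mathbf T_i$ for $j\ne i,i+1$; $\mathbf X_i\mathbf X_j=\mathbf X_j\mathbf X_i$; $\mathbf T_i\mathbf Y_i\mathbf T_i=\mathbf Y_{i+1}$; $\mathbf T_i\mathbf Y_j=\mathbf Y_j\mathbf T_i$ for $j\ne i,i+1$; $\mathbf Y_i\mathbf Y_j=\mathbf Y_j\mathbf Y_i$; $\mathbf Y_1\mathbf T_1\mathbf X_1=\mathbf X_2\mathbf Y_1\mathbf T_1$. For $w\in S_k$ with reduced expression $w=s_{i_\ell}\cdots s_{i_1}$ in simple transpositions, $\mathbf T_w=\mathbf T_{i_\ell}\cdots\mathbf T_{i_1}$. For $i\ge1$ let $\mathscr W_i$ be the free semigroup of finite (possibly empty) words in the two letters $\mathbf X_i,\mathbf Y_i$. The standard words are the elements of $$\mathscr S=\bigcup_{k\ge1}\mathscr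 S(k),\qquad \mathscr S(k)=\{\mathfrak u_1\mathfrak u_2\cdots\mathfrak u_k\mathbf T_w : w\in S_k,\ \mathfrak u_i\in\mathscr W_i,\ 1\le i\le k\},$$ viewed in $\mathcal H^+$ (symmetric groups are nested, $S_k\subset S_{k+1}$, so $\mathscr S(k)\subset\mathscr S(k+1)$; being a basis includes that distinct formal standard words, up to these identifications, are linearly independent). *)

theory Defs
  imports
    "HOL-Library.Poly_Mapping"
    "HOL-Computational_Algebra.Polynomial"
    "HOL-Computational_Algebra.Fraction_Field"
    "HOL-Combinatorics.Permutations"
begin

text \<open>
  All indices are shifted by one: generators, strands and permuted points are numbered
  \<open>0, 1, 2, \<dots>\<close> instead of \<open>1, 2, 3, \<dots>\<close>, and \<open>S\<^sub>k\<close> is the group of permutations of \<open>nat\<close>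
  that fix every point outside \<open>{..<k}\<close>; so \<open>S\<^sub>k \<subseteq> S\<^sub>k\<^sub>+\<^sub>1\<close> literally.
\<close>

text \<open>
  The ground field \<open>\<rat>(h,q)\<close>, as the fraction field of \<open>\<rat>[h][q]\<close>: the inner polynomial variable
  is \<open>h\<close>, the outer one is \<open>q\<close> (which does not occur in the relations).
\<close>

type_synonym K' = "rat poly poly fract"

definition h :: K' where
  "h = Fract [:[:0, 1:]:] 1"


subsection \<open>The free algebra\<close>

text \<open>
  \<open>T\<^sub>i\<close> is required to be invertible, so \<open>T\<^sub>i\<^sup>-\<^sup>1\<close> is a generator as well; the relations below make it
  the two-sided inverse of \<open>T\<^sub>i\<close>.
\<close>

datatype gen = GT nat | GTinv nat | GX nat | GY nat

datatype gword = GWord (gletters: "gen list")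

instantiation gword :: monoid_add
begin

definition zero_gword :: gword where
  "0 = GWord []"

definition plus_gword :: "gword \<Rightarrow> gword \<Rightarrow> gword" where
  "v + w = GWord (gletters v @ gletters w)"

instance
  by standard (simp_all add: zero_gword_def plus_gword_def)

end

text \<open>
  The monoid algebra of the free monoid on the generators: because the monoid is written additively
  here, the convolution product of \<^type>\<open>poly_mapping\<close> is the product of the free algebra.
\<close>

type_synonym falg = "gword \<Rightarrow>\<^sub>0 K'"

definition fgen :: "gen \<Rightarrow> falg" where
  "fgen g = Poly_Mapping.single (GWord [g]) 1"

definition fconst :: "K' \<Rightarrow> falg" where
  "fconst c = Poly_Mapping.single 0 c"

abbreviation "fT i \<equiv> fgen (GT i)"
abbreviation "fTi i \<equiv> fgen (GTinv i)"
abbreviation "fX i \<equiv> fgen (GX i)"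
abbreviation "fY i \<equiv> fgen (GY i)"


subsection \<open>The stable limit DAHA\<close>

inductive daha_rel :: "falg \<Rightarrow> falg \<Rightarrow> bool" where
  T_Tinv: "daha_rel (fT i * fTi i) 1"
| Tinv_T: "daha_rel (fTi i * fT i) 1"
| T_T: "i + 1 < j \<or> j + 1 < i \<Longrightarrow> daha_rel (fT i * fT j) (fT j * fT i)"
| braid: "daha_rel (fT i * fT (i + 1) * fT i) (fT (i + 1) * fT i * fT (i + 1))"
| quadratic: "daha_rel (fT i - fTi i) (fconst h)"
| T_X_T: "daha_rel (fTi i * fX i * fTi i) (fX (i + 1))"
| T_X: "j \<noteq> i \<Longrightarrow> j \<noteq> i + 1 \<Longrightarrow> daha_rel (fT i * fX j) (fX j * fT i)"
| X_X: "daha_rel (fX i * fX j) (fX j * fX i)"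
| T_Y_T: "daha_rel (fT i * fY i * fT i) (fY (i + 1))"
| T_Y: "j \<noteq> i \<Longrightarrow> j \<noteq> i + 1 \<Longrightarrow> daha_rel (fT i * fY j) (fY j * fT i)"
| Y_Y: "daha_rel (fY i * fY j) (fY j * fY i)"
| Y_T_X: "daha_rel (fY 0 * fT 0 * fX 0) (fX 1 * fY 0 * fT 0)"

text \<open>
  The smallest algebra congruence containing the relations; compatibility with scalars is the case
  of multiplication by \<^const>\<open>fconst\<close>.
\<close>

inductive daha_cong :: "falg \<Rightarrow> falg \<Rightarrow> bool" where
  rel: "daha_rel a b \<Longrightarrow> daha_cong a b"
| refl: "daha_cong a a"
| sym: "daha_cong a b \<Longrightarrow> daha_cong b a"
| trans: "daha_cong a b \<Longrightarrow> daha_cong b c \<Longrightarrow> daha_cong a c"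
| add: "daha_cong a b \<Longrightarrow> daha_cong c d \<Longrightarrow> daha_cong (a + c) (b + d)"
| mult: "daha_cong a b \<Longrightarrow> daha_cong c d \<Longrightarrow> daha_cong (a * c) (b * d)"

lemma equivp_daha_cong: "equivp daha_cong"
  by (intro equivpI reflpI sympI transpI) (auto intro: daha_cong.intros)

quotient_type daha = falg / daha_cong
  by (rule equivp_daha_cong)

lemma daha_cong_uminus: "daha_cong a b \<Longrightarrow> daha_cong (- a) (- b)"
  using daha_cong.mult[OF daha_cong.refl[of "- 1"], of a b] by simp

lemma abs_daha_surj: "\<exists>x. a = abs_daha x"
  by (induct a rule: daha.abs_induct) blast

instantiation daha :: "{ring, monoid_mult}"
begin

lift_definition zero_daha :: daha is 0 .
lift_definition one_daha :: daha is 1 .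
lift_definition plus_daha :: "daha \<Rightarrow> daha \<Rightarrow> daha" is "(+)" by (rule daha_cong.add)
lift_definition times_daha :: "daha \<Rightarrow> daha \<Rightarrow> daha" is "(*)" by (rule daha_cong.mult)
lift_definition uminus_daha :: "daha \<Rightarrow> daha" is uminus by (rule daha_cong_uminus)
lift_definition minus_daha :: "daha \<Rightarrow> daha \<Rightarrow> daha" is "(-)"
  by (metis daha_cong.add daha_cong_uminus diff_conv_add_uminus)

lemmas daha_abs_simps =
  zero_daha_def one_daha_def plus_daha.abs_eq times_daha.abs_eq uminus_daha.abs_eq minus_daha.abs_eq

instance
proof
  fix a b c :: daha
  obtain x y z where a: "a = abs_daha x" and b: "b = abs_daha y" and c: "c = abs_daha z"
    using abs_daha_surj by metis
  show "a + b + c = a + (b + c)" by (simp add: a b c daha_abs_simps add.assoc)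
  show "a + b = b + a" by (simp add: a b daha_abs_simps add.commute)
  show "0 + a = a" by (simp add: a daha_abs_simps)
  show "- a + a = 0" by (simp add: a daha_abs_simps)
  show "a - b = a + - b" by (simp add: a b daha_abs_simps)
  show "a * b * c = a * (b * c)" by (simp add: a b c daha_abs_simps mult.assoc)
  show "(a + b) * c = a * c + b * c" by (simp add: a b c daha_abs_simps distrib_right)
  show "a * (b + c) = a * b + a * c" by (simp add: a b c daha_abs_simps distrib_left)
  show "1 * a = a" by (simp add: a daha_abs_simps)
  show "a * 1 = a" by (simp add: a daha_abs_simps)
qed

end

lift_definition daha_scale :: "K' \<Rightarrow> daha \<Rightarrow> daha" is "\<lambda>c a. fconst c * a"
  by (intro daha_cong.mult daha_cong.refl)

lemma fconst_simps:
  "fconst (a + b) = fconst a + fconst b"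
  "fconst (a * b) = fconst a * fconst b"
  "fconst 1 = 1"
  by (simp_all add: fconst_def single_add mult_single)

interpretation daha: vector_space daha_scale
proof
  fix c d :: K' and a b :: daha
  obtain x y where a: "a = abs_daha x" and b: "b = abs_daha y"
    using abs_daha_surj by metis
  note [simp] = a b daha_abs_simps daha_scale.abs_eq fconst_simps
  show "daha_scale c (a + b) = daha_scale c a + daha_scale c b" by (simp add: distrib_left)
  show "daha_scale (c + d) a = daha_scale c a + daha_scale d a" by (simp add: distrib_right)
  show "daha_scale c (daha_scale d a) = daha_scale (c * d) a" by (simp add: mult.assoc)
  show "daha_scale 1 a = a" by simp
qed

lift_definition dT :: "nat \<Rightarrow> daha" is fT .
lift_definition dX :: "nat \<Rightarrow> daha" is fX .
lift_definition dY :: "nat \<Rightarrow> daha" is fY .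


subsection \<open>Standard words\<close>

definition perm_of :: "nat list \<Rightarrow> nat \<Rightarrow> nat" where
  "perm_of js = foldr (\<lambda>j w. transpose j (Suc j) \<circ> w) js id"

definition reduced_expr :: "nat list \<Rightarrow> (nat \<Rightarrow> nat) \<Rightarrow> bool" where
  "reduced_expr js w \<longleftrightarrow>
     perm_of js = w \<and> (\<forall>js'. perm_of js' = w \<longrightarrow> length js \<le> length js')"

text \<open>
  By Matsumoto's theorem and the braid relations, the product does not depend on the chosen reduced
  expression.
\<close>

definition T_perm :: "(nat \<Rightarrow> nat) \<Rightarrow> daha" where
  "T_perm w = prod_list (map dT (SOME js. reduced_expr js w))"

datatype letter = LX | LY

fun letter_val :: "nat \<Rightarrow> letter \<Rightarrow> daha" where
  "letter_val i LX = dX i"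
| "letter_val i LY = dY i"

text \<open>
  Formal standard words: a family of words, trivial from position \<open>k\<close> on, and an element of \<open>S\<^sub>k\<close>.
  The sets increase with \<open>k\<close>, which is the identification of formal words of different \<open>k\<close>.
\<close>

definition formal_words :: "nat \<Rightarrow> ((nat \<Rightarrow> letter list) \<times> (nat \<Rightarrow> nat)) set" where
  "formal_words k = {(u, w). (\<forall>i\<ge>k. u i = []) \<and> w permutes {..<k}}"

definition std_word :: "nat \<Rightarrow> (nat \<Rightarrow> letter list) \<times> (nat \<Rightarrow> nat) \<Rightarrow> daha" where
  "std_word k = (\<lambda>(u, w).
     prod_list (map (\<lambda>i. prod_list (map (letter_val i) (u i))) [0..<k]) * T_perm w)"

definition std_words :: "nat \<Rightarrow> daha set" where
  "std_words k = std_word k ` formal_words k"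

definition all_std_words :: "daha set" where
  "all_std_words = (\<Union>k\<in>{1..}. std_words k)"

lemma formal_words_mono: "k \<le> l \<Longrightarrow> formal_words k \<subseteq> formal_words l"
  by (auto simp: formal_words_def intro: permutes_subset)

lemma std_word_stable:
  assumes "p \<in> formal_words k" "k \<le> l"
  shows "std_word l p = std_word k p"
proof -
  obtain u w where p: "p = (u, w)" by (cases p)
  let ?f = "\<lambda>i. prod_list (map (letter_val i) (u i))"
  have u: "u i = []" if "i \<ge> k" for i
    using assms(1) that by (simp add: p formal_words_def)
  have "map ?f [k..<l] = map (\<lambda>_. 1) [k..<l]"
    by (rule map_cong) (auto simp: u)
  then have "prod_list (map ?f [k..<l]) = 1"
    by (simp add: map_replicate_const)
  moreover have "[0..<l] = [0..<k] @ [k..<l]"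
    using upt_add_eq_append[of 0 k "l - k"] assms(2) by simp
  ultimately show ?thesis
    by (simp add: p std_word_def)
qed

end

theory Submission
  imports Defs
begin

text \<open>
  Write \<open>Z\<^sub>i\<^sup>l\<close> for the generator with letter \<open>l\<close> on strand \<open>i\<close>. Put \<open>\<tau> = T\<^sub>i\<close>, \<open>\<kappa> = h\<close> for \<open>l = X\<close> and
  \<open>\<tau> = T\<^sub>i\<^sup>-\<^sup>1\<close>, \<open>\<kappa> = - h\<close> for \<open>l = Y\<close>, so that \<open>\<tau> - \<tau>\<^sup>-\<^sup>1 = \<kappa>\<close>. Then both letters obey the same rules,
  \<open>Z\<^sub>i\<^sub>+\<^sub>1\<^sup>l = \<tau>\<^sup>-\<^sup>1 Z\<^sub>i\<^sup>l \<tau>\<^sup>-\<^sup>1\<close>, and in the algebra one finds, for \<open>l \<noteq> m\<close>,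
  \<open>Z\<^sub>i\<^sub>+\<^sub>1\<^sup>l Z\<^sub>i\<^sup>m = Z\<^sub>i\<^sup>m Z\<^sub>i\<^sub>+\<^sub>1\<^sup>l + \<kappa> Z\<^sub>i\<^sup>m Z\<^sub>i\<^sup>l \<tau>\<^sup>-\<^sup>1\<close> (\<open>letter_exchange\<close>), while equal letters commute. This
  symmetry, which exchanges \<open>X\<close> with \<open>Y\<close>, \<open>T\<close> with \<open>T\<^sup>-\<^sup>1\<close> and \<open>h\<close> with \<open>- h\<close>, halves the calculations below.

  Spanning: the exchange rule sorts letters by strand, and \<open>T\<^sub>i\<close> moves to the right through a word on
  strands \<open>i\<close> and \<open>i + 1\<close>, leaving such words times \<open>1\<close> or \<open>T\<^sub>i\<close> (\<open>strand_span_left\<close>). The remaining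
  \<open>T\<^sub>i\<close> is absorbed by \<open>T\<^sub>w\<close>, where Matsumoto's theorem makes \<open>T\<^sub>w\<close> independent of the chosen reduced
  expression (\<open>T_perm_left\<close>). Hence the span is a left ideal that contains \<open>1\<close>.

  Independence: the algebra acts on the vector space with the formal standard words as basis in such
  a way that every standard word sends the empty word to the basis vector with its own name
  (\<open>daha_op_std_word\<close>). The sorting rules leave no choice for this action: \<open>Z\<^sub>0\<^sup>l\<close> prepends a letter, and
  \<open>T\<^sub>i\<close> is determined by recursion on the number of letters on strands \<open>i\<close> and \<open>i + 1\<close>, together with
  the letters \<open>Z\<^sub>i\<^sub>+\<^sub>1\<^sup>l\<close> acting on these two strands. What needs proof is that the relations hold. On two
  strands this is an induction on the number of letters (\<open>two_strands\<close>). The braid relation is the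
  crux: it is proved on three strands together with two companions, namely that \<open>T\<^sub>i\<close> commutes with the
  letters on strand \<open>i + 2\<close> and that letters on strands \<open>i + 1\<close> and \<open>i + 2\<close> obey the exchange rule. Each of
  the three statements for \<open>n + 1\<close> letters follows from all three for \<open>n\<close> letters (\<open>three_strands\<close>);
  it is the confluence of the sorting rules on words with three letters on three different strands.
\<close>

section \<open>Linear algebra of finitely supported functions\<close>

abbreviation (input) "keys \<equiv> Poly_Mapping.keys"
abbreviation (input) "lookup \<equiv> Poly_Mapping.lookup"

definition scale :: "'k \<Rightarrow> ('b \<Rightarrow>\<^sub>0 'k) \<Rightarrow> ('b \<Rightarrow>\<^sub>0 'k :: comm_ring_1)" where
  "scale c m = Poly_Mapping.map ((*) c) m"

abbreviation ket :: "'b \<Rightarrow> ('b \<Rightarrow>\<^sub>0 'k :: comm_ring_1)" where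
  "ket b \<equiv> Poly_Mapping.single b 1"

definition lin :: "('b \<Rightarrow> ('c \<Rightarrow>\<^sub>0 'k)) \<Rightarrow> ('b \<Rightarrow>\<^sub>0 'k) \<Rightarrow> ('c \<Rightarrow>\<^sub>0 'k :: comm_ring_1)" where
  "lin f m = (\<Sum>b\<in>keys m. scale (lookup m b) (f b))"

lemma lookup_scale [simp]: "lookup (scale c m) b = c * lookup m b"
  by (auto simp: scale_def Poly_Mapping.map.rep_eq when_def)

lemma scale_simps [simp]:
  "scale 0 m = 0" "scale c 0 = 0" "scale 1 m = m" "scale c (scale d m) = scale (c * d) m"
  by (auto intro!: poly_mapping_eqI simp: mult.assoc)

lemma scale_add: "scale c (x + y) = scale c x + scale c y"
  "scale (c + d) x = scale c x + scale d x"
  by (auto intro!: poly_mapping_eqI simp: lookup_add algebra_simps)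

lemma scale_diff: "scale c (x - y) = scale c x - scale c y"
  "scale (c - d) x = scale c x - scale d x"
  by (auto intro!: poly_mapping_eqI simp: lookup_minus right_diff_distrib left_diff_distrib)

lemma scale_minus: "scale (- c) x = - scale c x" "scale c (- x) = - scale c x"
  by (auto intro!: poly_mapping_eqI)

lemma scale_sum: "scale c (sum g A) = (\<Sum>a\<in>A. scale c (g a))"
  by (rule poly_mapping_eqI) (simp add: lookup_sum sum_distrib_left)

lemma lin_superset:
  assumes "finite A" "keys m \<subseteq> A"
  shows "lin f m = (\<Sum>b\<in>A. scale (lookup m b) (f b))"
  unfolding lin_def using assms
  by (intro sum.mono_neutral_left) (auto simp: in_keys_iff)

text \<open>
  A predicate on functions, so that linearity of composites is settled by rewriting with the facts
  collected in \<open>lin_simps\<close>.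
\<close>
definition linop :: "(('b \<Rightarrow>\<^sub>0 'k) \<Rightarrow> ('c \<Rightarrow>\<^sub>0 'k :: comm_ring_1)) \<Rightarrow> bool" where
  "linop F \<longleftrightarrow> (\<forall>x y. F (x + y) = F x + F y) \<and> (\<forall>c x. F (scale c x) = scale c (F x))"

lemma linop_add: "linop F \<Longrightarrow> F (x + y) = F x + F y"
  and linop_scale: "linop F \<Longrightarrow> F (scale c x) = scale c (F x)"
  by (auto simp: linop_def)

lemma linop_zero: "linop F \<Longrightarrow> F 0 = 0"
  using linop_scale[of F 0 0] by simp

lemma linop_minus: "linop F \<Longrightarrow> F (- x) = - F x"
  using linop_scale[of F "-1" x] by (simp add: scale_minus)

lemma linop_diff: "linop F \<Longrightarrow> F (x - y) = F x - F y"
  using linop_add[of F x "-y"] by (simp add: linop_minus[of F])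

lemma linop_sum: "linop F \<Longrightarrow> F (sum g A) = (\<Sum>a\<in>A. F (g a))"
  by (induct A rule: infinite_finite_induct) (auto simp: linop_zero[of F] linop_add[of F])

lemmas linop_simps = linop_add linop_scale linop_zero linop_minus linop_diff

lemma linop_lin [simp]: "linop (lin f)"
  unfolding linop_def
proof safe
  fix x y :: "'a \<Rightarrow>\<^sub>0 'b"
  let ?A = "keys x \<union> keys y"
  have "keys (x + y) \<subseteq> ?A" by (rule keys_add)
  then show "lin f (x + y) = lin f x + lin f y"
    by (simp add: lin_superset[of ?A] lookup_add scale_add sum.distrib)
next
  fix c and x :: "'a \<Rightarrow>\<^sub>0 'b"
  have "keys (scale c x) \<subseteq> keys x"
    by (auto simp: in_keys_iff)
  then show "lin f (scale c x) = scale c (lin f x)"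
    by (simp add: lin_superset[of "keys x"] scale_sum)
qed

lemma lin_ket [simp]: "lin f (ket b) = f b"
  by (simp add: lin_superset[of "{b}"])

lemma ket_expansion: "m = (\<Sum>b\<in>keys m. scale (lookup m b) (ket b))"
  by (rule poly_mapping_eqI)
    (simp add: lookup_sum lookup_single when_def in_keys_iff if_distrib cong: if_cong)

lemma lin_cong: "(\<And>b. b \<in> keys m \<Longrightarrow> f b = g b) \<Longrightarrow> lin f m = lin g m"
  by (simp add: lin_def)

lemma linop_expansion:
  assumes "linop F"
  shows "F m = (\<Sum>b\<in>keys m. scale (lookup m b) (F (ket b)))"
proof -
  have "F m = F (\<Sum>b\<in>keys m. scale (lookup m b) (ket b))"
    by (rule arg_cong[OF ket_expansion])
  also have "\<dots> = (\<Sum>b\<in>keys m. F (scale (lookup m b) (ket b)))"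
    by (rule linop_sum[OF assms])
  finally show ?thesis by (simp only: linop_scale[OF assms])
qed

named_theorems lin_simps

lemmas [lin_simps] = scale_add scale_diff scale_minus

definition supported :: "('b \<Rightarrow> bool) \<Rightarrow> ('b \<Rightarrow>\<^sub>0 'k :: comm_ring_1) \<Rightarrow> bool" where
  "supported P m \<longleftrightarrow> (\<forall>b\<in>keys m. P b)"

lemma supported_ket [simp]: "supported P (ket b) \<longleftrightarrow> P b"
  by (simp add: supported_def)
lemma supported_0 [simp]: "supported P 0" by (simp add: supported_def)
lemma supported_add: "supported P x \<Longrightarrow> supported P y \<Longrightarrow> supported P (x + y)"
  unfolding supported_def using keys_add[of x y] by blast
lemma supported_scale: "supported P x \<Longrightarrow> supported P (scale c x)"
  by (auto simp: supported_def in_keys_iff)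
lemma supported_diff: "supported P x \<Longrightarrow> supported P y \<Longrightarrow> supported P (x - y)"
  using supported_add[of P x "scale (-1) y"] supported_scale[of P y "-1"] by (simp add: scale_minus)
lemma supported_sum: "(\<And>a. a \<in> A \<Longrightarrow> supported P (g a)) \<Longrightarrow> supported P (sum g A)"
  by (induct A rule: infinite_finite_induct) (auto intro: supported_add)
lemmas supported_intros = supported_add supported_scale supported_diff
lemma supported_mono: "supported P m \<Longrightarrow> (\<And>b. P b \<Longrightarrow> Q b) \<Longrightarrow> supported Q m"
  by (auto simp: supported_def)

lemma supported_linop:
  assumes "linop F" "\<And>b. P b \<Longrightarrow> supported Q (F (ket b))" "supported P m"
  shows "supported Q (F m)"
  unfolding linop_expansion[OF assms(1), of m]
  using assms(2,3) by (auto simp: supported_def[of P] intro!: supported_sum supported_scale)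

text \<open>
  Equations between linear maps on the vectors supported in \<open>P\<close> need checking on basis vectors only;
  the last three cases are closed by \<open>lin_simps\<close>.
\<close>
lemma supported_induct [consumes 1, case_names ket zero add scale]:
  assumes "supported P m" "\<And>b. P b \<Longrightarrow> Q (ket b)" "Q 0"
    "\<And>x y. Q x \<Longrightarrow> Q y \<Longrightarrow> Q (x + y)" "\<And>c x. Q x \<Longrightarrow> Q (scale c x)"
  shows "Q m"
proof -
  have "Q (\<Sum>b\<in>A. scale (lookup m b) (ket b))" if "finite A" "A \<subseteq> keys m" for A
    using that assms by (induct A) (auto simp: supported_def)
  from this[of "keys m"] show ?thesis
    by (simp flip: ket_expansion)
qed

lemma ket_induct [case_names ket zero add scale]:
  assumes "\<And>b. Q (ket b)" "Q 0"
    "\<And>x y. Q x \<Longrightarrow> Q y \<Longrightarrow> Q (x + y)" "\<And>c x. Q x \<Longrightarrow> Q (scale c x)"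
  shows "Q m"
  using assms supported_induct[of "\<lambda>_. True" m Q] by (auto simp: supported_def)

lemma ket_eq_iff [simp]: "(ket b :: 'b \<Rightarrow>\<^sub>0 'k :: comm_ring_1) = ket c \<longleftrightarrow> b = c"
proof
  assume "(ket b :: 'b \<Rightarrow>\<^sub>0 'k) = ket c"
  then have "keys (ket b :: 'b \<Rightarrow>\<^sub>0 'k) = keys (ket c :: 'b \<Rightarrow>\<^sub>0 'k)" by simp
  then show "b = c" by simp
qed simp

section \<open>Reduced expressions and Matsumoto's theorem\<close>

lemma perm_of_Nil: "perm_of [] = id"
  and perm_of_Cons: "perm_of (j # js) = transpose j (Suc j) \<circ> perm_of js"
  by (simp_all add: perm_of_def)

lemma perm_of_append: "perm_of (xs @ ys) = perm_of xs \<circ> perm_of ys"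
  by (induct xs) (simp_all add: perm_of_Nil perm_of_Cons o_assoc)

lemma bij_perm_of: "bij (perm_of js)"
proof (induct js)
  case Nil
  show ?case unfolding perm_of_Nil by (rule bij_id)
next
  case (Cons j js)
  show ?case unfolding perm_of_Cons by (rule bij_comp[OF Cons]) (rule bij_transpose)
qed

lemma inv_perm_of_Nil: "inv (perm_of []) x = x"
  unfolding perm_of_Nil by simp

lemma inv_perm_of_Cons: "inv (perm_of (j # js)) = inv (perm_of js) \<circ> transpose j (Suc j)"
  unfolding perm_of_Cons
  by (subst o_inv_distrib) (simp_all only: bij_perm_of bij_transpose inv_transpose_eq)

lemma inv_perm_of_Cons_apply: "inv (perm_of (j # js)) x = inv (perm_of js) (transpose j (Suc j) x)"
  by (simp only: inv_perm_of_Cons o_apply)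

lemma perm_of_cong: "perm_of js = perm_of js' \<Longrightarrow> perm_of (j # js) = perm_of (j # js')"
  by (simp only: perm_of_Cons)

lemma perm_of_cancel: "perm_of (j # j # js) = perm_of js"
  by (simp add: perm_of_Cons o_assoc)

lemma transpose_far:
  "i + 1 < j \<Longrightarrow> transpose i (Suc i) (transpose j (Suc j) x) = transpose j (Suc j) (transpose i (Suc i) x)"
  by (auto simp: transpose_def)

lemma transpose_braid:
  "transpose i (Suc i) (transpose (Suc i) (Suc (Suc i)) (transpose i (Suc i) x)) =
   transpose (Suc i) (Suc (Suc i)) (transpose i (Suc i) (transpose (Suc i) (Suc (Suc i)) x))"
  by (auto simp: transpose_def)

lemma perm_of_far: "i + 1 < j \<Longrightarrow> perm_of (i # j # js) = perm_of (j # i # js)"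
  by (rule ext, simp only: perm_of_Cons o_apply, rule transpose_far)

lemma perm_of_braid: "perm_of (i # Suc i # i # js) = perm_of (Suc i # i # Suc i # js)"
  by (rule ext) (simp only: perm_of_Cons o_apply transpose_braid)

text \<open>
  The strong exchange property. Read \<open>js\<close> as a sequence of crossings: if \<open>a < b\<close> arrive in the wrong
  order, they cross somewhere, and deleting that crossing swaps them back.
\<close>
lemma exchange:
  assumes "a < b" "inv (perm_of js) b < inv (perm_of js) a"
  shows "\<exists>js'. length js = Suc (length js') \<and> perm_of js' = transpose a b \<circ> perm_of js"
  using assms
proof (induct js arbitrary: a b)
  case Nil
  then show ?case by (simp only: inv_perm_of_Nil)
next
  case (Cons j js)
  let ?s = "transpose j (Suc j)"
  have inv: "inv (perm_of js) (?s b) < inv (perm_of js) (?s a)"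
    using Cons(3) by (simp only: inv_perm_of_Cons_apply)
  show ?case
  proof (cases "?s a < ?s b")
    case True
    obtain js' where js': "length js = Suc (length js')" "perm_of js' = transpose (?s a) (?s b) \<circ> perm_of js"
      using Cons(1)[OF True inv] by blast
    have "?s \<circ> transpose (?s a) (?s b) = transpose a b \<circ> ?s"
      using transpose_comp_eq[of ?s a b] by (simp only: bij_transpose inv_transpose_eq)
    then have "perm_of (j # js') = transpose a b \<circ> perm_of (j # js)"
      by (simp add: js' perm_of_Cons o_assoc)
    with js' show ?thesis by (intro exI[of _ "j # js'"]) simp
  next
    case False
    then have "a = j \<and> b = Suc j"
      using Cons(2) unfolding transpose_def by presburger
    then have "a = j" "b = Suc j" by simp_all
    then show ?thesis
      by (intro exI[of _ js]) (simp add: perm_of_Cons o_assoc)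
  qed
qed

definition reduced :: "nat list \<Rightarrow> bool" where
  "reduced js \<longleftrightarrow> reduced_expr js (perm_of js)"

lemma reduced_le: "reduced js \<Longrightarrow> perm_of js' = perm_of js \<Longrightarrow> length js \<le> length js'"
  by (auto simp: reduced_def reduced_expr_def)

lemma reducedI: "(\<And>js'. perm_of js' = perm_of js \<Longrightarrow> length js \<le> length js') \<Longrightarrow> reduced js"
  by (auto simp: reduced_def reduced_expr_def)

lemma reduced_same_length: "reduced js \<Longrightarrow> perm_of js' = perm_of js \<Longrightarrow> length js' = length js \<Longrightarrow> reduced js'"
  by (rule reducedI) (simp add: reduced_le)

lemma reduced_tail:
  assumes "reduced (j # js)"
  shows "reduced js"
proof (rule reducedI)
  fix js' assume "perm_of js' = perm_of js"
  then show "length js \<le> length js'"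
    using reduced_le[OF assms, of "j # js'"] perm_of_cong[of js' js] by simp
qed

lemma exchange_adjacent:
  assumes "inv (perm_of js) (Suc j) < inv (perm_of js) j"
  obtains js' where "length js = Suc (length js')" "perm_of js' = perm_of (j # js)"
  using exchange[OF _ assms] by (auto simp: perm_of_Cons)

text \<open>
  Otherwise the exchange property yields an expression for the same permutation that is shorter by two.
\<close>
lemma reduced_ascent:
  assumes "reduced (j # js)"
  shows "inv (perm_of js) j < inv (perm_of js) (Suc j)"
proof (rule ccontr)
  assume "\<not> ?thesis"
  moreover have "inv (perm_of js) j \<noteq> inv (perm_of js) (Suc j)"
    by (simp add: inj_eq[OF bij_is_inj[OF bij_imp_bij_inv[OF bij_perm_of]]])
  ultimately have "inv (perm_of js) (Suc j) < inv (perm_of js) j" by linarith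
  then obtain js' where "length js = Suc (length js')" "perm_of js' = perm_of (j # js)"
    by (rule exchange_adjacent)
  with reduced_le[OF assms, of js'] show False by simp
qed

lemma reduced_Cons:
  assumes "reduced js" "inv (perm_of js) j < inv (perm_of js) (Suc j)"
  shows "reduced (j # js)"
proof (rule reducedI)
  fix js' assume js': "perm_of js' = perm_of (j # js)"
  have "inv (perm_of js') (Suc j) < inv (perm_of js') j"
    using assms(2) unfolding js' inv_perm_of_Cons_apply by simp
  then obtain js'' where "length js' = Suc (length js'')" "perm_of js'' = perm_of (j # js')"
    by (rule exchange_adjacent)
  moreover have "perm_of (j # js') = perm_of js"
    using perm_of_cong[OF js', of j] unfolding perm_of_cancel .
  ultimately have "length js' = Suc (length js'')" "perm_of js'' = perm_of js" by simp_all
  with reduced_le[OF assms(1), of js''] show "length (j # js) \<le> length js'" by simp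
qed

lemma reduced_descent:
  assumes "reduced js" "inv (perm_of js) (Suc j) < inv (perm_of js) j"
  obtains js' where "reduced (j # js')" "perm_of (j # js') = perm_of js" "length js = Suc (length js')"
proof -
  from assms(2) obtain js' where js': "length js = Suc (length js')" "perm_of js' = perm_of (j # js)"
    by (rule exchange_adjacent)
  have p: "perm_of (j # js') = perm_of js"
    using perm_of_cong[OF js'(2), of j] unfolding perm_of_cancel .
  have "reduced (j # js')" by (rule reduced_same_length[OF assms(1) p]) (simp only: js'(1) list.size)
  then show thesis using p js'(1) by (rule that)
qed

text \<open>
  Induction on the length. Two reduced expressions that start with different letters \<open>s\<close> and \<open>r\<close>
  represent a permutation with descents at \<open>s\<close> and at \<open>r\<close>. Hence it also has reduced expressions that
  start with the two sides of the commutation or braid relation for \<open>s\<close> and \<open>r\<close>, followed by the same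
  rest, and the induction hypothesis links each of these with one of the given expressions.
\<close>
theorem matsumoto:
  fixes t :: "nat \<Rightarrow> 'a :: monoid_mult"
  assumes far: "\<And>i j. i + 1 < j \<Longrightarrow> t i * t j = t j * t i"
    and braid: "\<And>i. t i * t (Suc i) * t i = t (Suc i) * t i * t (Suc i)"
    and "reduced js" "reduced js'" "perm_of js = perm_of js'"
  shows "prod_list (map t js) = prod_list (map t js')"
  using assms(3-)
proof (induct "length js" arbitrary: js js' rule: less_induct)
  case less
  let ?t = "\<lambda>js. prod_list (map t js)"
  have IH: "?t x = ?t y" if "reduced x" "reduced y" "perm_of x = perm_of y" "length x < length js" for x y
    using less(1)[OF that(4) that(1,2,3)] .
  have len: "length js' = length js"
    using reduced_le[OF less(2), of js'] reduced_le[OF less(3), of js] less(4) by simp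
  show ?case
  proof (cases js)
    case Nil
    then show ?thesis using len by simp
  next
    case (Cons s x)
    then obtain r y where js': "js' = r # y" using len by (cases js') auto
    have *: "?t (s # x) = ?t (r # y)"
      if sr: "s < r" and rx: "reduced (s # x)" "reduced (r # y)" and p: "perm_of (s # x) = perm_of (r # y)"
        and l: "length x < length js" "length x = length y" for s r x y
    proof -
      let ?i = "inv (perm_of x)"
      have py: "perm_of y = perm_of (r # s # x)"
        using perm_of_cong[OF p, of r] by (simp only: perm_of_cancel)
      have as: "?i s < ?i (Suc s)" using reduced_ascent[OF rx(1)] .
      have "inv (perm_of y) r < inv (perm_of y) (Suc r)" using reduced_ascent[OF rx(2)] .
      then have ar: "?i (transpose s (Suc s) (Suc r)) < ?i (transpose s (Suc s) r)"
        by (simp only: py inv_perm_of_Cons_apply transpose_apply_first transpose_apply_second)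
      note redx = reduced_tail[OF rx(1)] and redy = reduced_tail[OF rx(2)]
      show ?thesis
      proof (cases "r = Suc s")
        case False
        with sr ar have "?i (Suc r) < ?i r" by (simp only: transpose_def) auto
        then obtain z where z: "reduced (r # z)" "perm_of (r # z) = perm_of x" "length x = Suc (length z)"
          by (rule reduced_descent[OF redx])
        have "perm_of (s # r # z) = perm_of (r # s # z)"
          by (rule perm_of_far) (use sr False in simp)
        then have "perm_of (r # s # r # z) = perm_of (r # r # s # z)" by (rule perm_of_cong)
        moreover have "perm_of y = perm_of (r # s # r # z)"
          unfolding py by (intro perm_of_cong) (simp only: z(2))
        ultimately have pz: "perm_of (s # z) = perm_of y" by (simp only: perm_of_cancel)
        then have "reduced (s # z)" using z(3) l by (intro reduced_same_length[OF redy]) auto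
        then have "?t (s # z) = ?t y" using pz redy l z(3) by (intro IH) auto
        moreover have "?t (r # z) = ?t x" using z redx l by (intro IH) auto
        ultimately have "?t (s # x) = t s * t r * ?t z" "?t (r # y) = t r * t s * ?t z"
          by (simp_all add: mult.assoc)
        then show ?thesis using far[of s r] sr False by simp
      next
        case True
        with ar have a2: "?i (Suc r) < ?i s" by (simp only: transpose_def) simp
        with as have "?i (Suc r) < ?i r" by (simp only: True)
        then obtain z where z: "reduced (r # z)" "perm_of (r # z) = perm_of x" "length x = Suc (length z)"
          by (rule reduced_descent[OF redx])
        have "inv (perm_of (r # z)) (Suc r) < inv (perm_of (r # z)) s"
          using a2 by (simp only: z(2))
        then have "inv (perm_of z) (Suc s) < inv (perm_of z) s"
          by (simp only: inv_perm_of_Cons_apply) (simp only: True transpose_def, simp)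
        then obtain c where c: "reduced (s # c)" "perm_of (s # c) = perm_of z" "length z = Suc (length c)"
          by (rule reduced_descent[OF reduced_tail[OF z(1)]])
        have "perm_of (s # r # c) = perm_of (r # r # s # r # c)"
          by (simp only: perm_of_cancel)
        also have "\<dots> = perm_of (r # s # r # s # c)"
          using perm_of_cong[OF perm_of_braid[of s c], of r] by (simp only: True)
        also have "\<dots> = perm_of (r # s # x)"
          by (intro perm_of_cong) (simp only: perm_of_cong[OF c(2)] z(2))
        finally have pz: "perm_of (s # r # c) = perm_of y" by (simp only: py)
        then have "reduced (s # r # c)" using z(3) c(3) l by (intro reduced_same_length[OF redy]) auto
        then have "?t (s # r # c) = ?t y" using pz redy l z(3) c(3) by (intro IH) auto
        moreover have "?t (r # z) = ?t x" using z redx l by (intro IH) auto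
        moreover have "?t (s # c) = ?t z" using c z reduced_tail[OF z(1)] l by (intro IH) auto
        ultimately have "?t (s # x) = t s * t r * t s * ?t c" "?t (r # y) = t r * t s * t r * ?t c"
          by (simp_all add: mult.assoc)
        then show ?thesis using braid[of s] True by simp
      qed
    qed
    consider "s = r" | "s < r" | "r < s" by linarith
    then show ?thesis
    proof cases
      case 1
      have "perm_of (s # js) = perm_of (s # js')" using less(4) by (rule perm_of_cong)
      then have "perm_of x = perm_of y"
        unfolding Cons js' 1 by (simp only: perm_of_cancel)
      then show ?thesis
        using IH[of x y] reduced_tail less(2,3) Cons js' 1 by auto
    next
      case 2
      then show ?thesis using *[of s r x y] less(2-4) Cons js' len by simp
    next
      case 3
      then show ?thesis using *[of r s y x] less(2-4) Cons js' len by simp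
    qed
  qed
qed

lemma perm_of_transpose: "a < b \<Longrightarrow> \<exists>js. perm_of js = transpose a b"
proof (induct b)
  case (Suc b)
  show ?case
  proof (cases "a = b")
    case True
    then show ?thesis by (intro exI[of _ "[a]"]) (simp add: perm_of_Cons perm_of_Nil)
  next
    case False
    then obtain js where "perm_of js = transpose a b" using Suc by auto
    moreover have "transpose b (Suc b) \<circ> (transpose a b \<circ> transpose b (Suc b)) = transpose a (Suc b)"
      using Suc(2) False by (intro ext) (auto simp: transpose_def)
    ultimately show ?thesis
      by (intro exI[of _ "b # js @ [b]"]) (simp add: perm_of_append perm_of_Cons perm_of_Nil)
  qed
qed simp

lemma perm_of_surj:
  assumes "w permutes {..<k::nat}"
  shows "\<exists>js. perm_of js = w"
  using assms finite_lessThan[of k]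
proof (induct w rule: permutes_induct)
  case id
  show ?case by (rule exI[of _ "[]"]) (rule perm_of_Nil)
next
  case (swap a b p)
  then obtain js where js: "perm_of js = p" by auto
  consider "a < b" | "b < a" | "a = b" by linarith
  then obtain js' where "perm_of js' = transpose a b"
  proof cases
    case 1
    then obtain js' where "perm_of js' = transpose a b" using perm_of_transpose by blast
    then show thesis by (rule that)
  next
    case 2
    then obtain js' where "perm_of js' = transpose b a" using perm_of_transpose by blast
    then show thesis by (intro that) (simp only: transpose_commute)
  next
    case 3
    then show thesis using that[of "[]"] by (simp add: perm_of_Nil)
  qed
  with js show ?case by (intro exI[of _ "js' @ js"]) (simp add: perm_of_append)
qed

lemma reduced_expr_ex:
  assumes "w permutes {..<k}"
  shows "\<exists>js. reduced_expr js w"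
proof -
  obtain js where "perm_of js = w" using perm_of_surj[OF assms] by blast
  then obtain js' where js': "perm_of js' = w" "\<forall>m<length js'. \<not> (\<exists>js. perm_of js = w \<and> length js = m)"
    using exists_least_iff[of "\<lambda>n. \<exists>js. perm_of js = w \<and> length js = n"] by blast
  have "length js' \<le> length js''" if "perm_of js'' = w" for js''
    using js'(2) that not_less by blast
  with js'(1) show ?thesis
    unfolding reduced_expr_def by blast
qed

section \<open>The space of formal standard words\<close>

text \<open>
  A permutation \<open>w\<close> is recorded by its inverse \<open>f\<close>, the list of positions of the values: then
  \<open>s\<^sub>i w\<close> becomes \<open>f \<circ> s\<^sub>i\<close>, and the length goes up iff \<open>f i < f (i + 1)\<close>. The braid relation for the
  resulting regular representation of the Hecke algebra is then checked by comparing three values of \<open>f\<close>,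
  where injectivity excludes ties.
\<close>
typedef arrangement = "{f :: nat \<Rightarrow> nat. inj f}" morphisms position Arrangement
  by (rule exI[of _ id]) simp

setup_lifting type_definition_arrangement

lift_definition swap_at :: "nat \<Rightarrow> arrangement \<Rightarrow> arrangement" is "\<lambda>i f. f \<circ> transpose i (Suc i)"
  by (rule inj_compose) simp_all

lemma position_swap_at: "position (swap_at i f) j = position f (transpose i (Suc i) j)"
  by transfer simp

lemma position_eq: "position f i = position f j \<longleftrightarrow> i = j"
  by transfer (simp add: inj_eq)

lemma arrangement_eqI: "(\<And>j. position f j = position g j) \<Longrightarrow> f = g"
  by transfer auto

lemma swap_at_swap_at [simp]: "swap_at i (swap_at i f) = f"
  by (rule arrangement_eqI) (simp add: position_swap_at)

lemma swap_at_far: "i + 1 < j \<or> j + 1 < i \<Longrightarrow> swap_at i (swap_at j f) = swap_at j (swap_at i f)"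
  by (rule arrangement_eqI) (auto simp: position_swap_at transpose_def)

lemma swap_at_braid: "swap_at i (swap_at (Suc i) (swap_at i f)) = swap_at (Suc i) (swap_at i (swap_at (Suc i) f))"
  by (rule arrangement_eqI) (auto simp: position_swap_at transpose_def)

type_synonym index = "(nat \<Rightarrow> letter list) \<times> arrangement"
type_synonym std_space = "index \<Rightarrow>\<^sub>0 K'"

definition prepend :: "nat \<Rightarrow> letter \<Rightarrow> std_space \<Rightarrow> std_space" where
  "prepend j l = lin (\<lambda>(u, f). ket (u(j := l # u j), f))"

definition hecke_op :: "nat \<Rightarrow> std_space \<Rightarrow> std_space" where
  "hecke_op i = lin (\<lambda>(u, f). ket (u, swap_at i f) + (if position f (Suc i) < position f i then scale h (ket (u, f)) else 0))"

lemma linop_prepend [simp]: "linop (prepend j l)" by (simp add: prepend_def)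
lemma linop_hecke_op [simp]: "linop (hecke_op i)" by (simp add: hecke_op_def)
lemmas prepend_lin [lin_simps] = linop_simps[OF linop_prepend]
lemmas hecke_op_lin [lin_simps] = linop_simps[OF linop_hecke_op]
lemma prepend_ket: "prepend j l (ket (u, f)) = ket (u(j := l # u j), f)" by (simp add: prepend_def)
lemma hecke_op_ket: "hecke_op i (ket (u, f)) = ket (u, swap_at i f) + (if position f (Suc i) < position f i then scale h (ket (u, f)) else 0)"
  by (simp add: hecke_op_def)

lemma position_less: "i \<noteq> j \<Longrightarrow> \<not> position f i < position f j \<longleftrightarrow> position f j < position f i"
  using position_eq[of f i j] by linarith

lemma hecke_op_quad: "hecke_op i (hecke_op i m) = m + scale h (hecke_op i m)"
proof (induct m rule: ket_induct)
  case (ket b)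
  obtain u f where b: "b = (u, f)" by (cases b)
  show "hecke_op i (hecke_op i (ket b)) = ket b + scale h (hecke_op i (ket b))"
    using position_less[of i "Suc i" f]
    by (auto simp: b hecke_op_ket position_swap_at lin_simps)
qed (simp_all add: lin_simps algebra_simps)

lemma hecke_op_far:
  assumes "i + 1 < j \<or> j + 1 < i"
  shows "hecke_op i (hecke_op j m) = hecke_op j (hecke_op i m)"
proof (induct m rule: ket_induct)
  case (ket b)
  obtain u f where b: "b = (u, f)" by (cases b)
  show "hecke_op i (hecke_op j (ket b)) = hecke_op j (hecke_op i (ket b))"
    using assms
    by (auto simp: b hecke_op_ket position_swap_at lin_simps swap_at_far algebra_simps)
qed (simp_all add: lin_simps algebra_simps)

lemma hecke_op_braid:
  "hecke_op i (hecke_op (Suc i) (hecke_op i m)) = hecke_op (Suc i) (hecke_op i (hecke_op (Suc i) m))"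
proof (induct m rule: ket_induct)
  case (ket b)
  obtain u f where b: "b = (u, f)" by (cases b)
  let ?x = "position f i" and ?y = "position f (Suc i)" and ?z = "position f (Suc (Suc i))"
  have ne: "?x \<noteq> ?y" "?x \<noteq> ?z" "?y \<noteq> ?z" by (auto simp: position_eq)
  have tr: "transpose i (Suc i) (Suc (Suc i)) = Suc (Suc i)"
    "transpose (Suc i) (Suc (Suc i)) i = i" by (auto simp: transpose_def)
  consider "?x < ?y" "?y < ?z" | "?x < ?z" "?z < ?y" | "?y < ?x" "?x < ?z" | "?y < ?z" "?z < ?x"
    | "?z < ?x" "?x < ?y" | "?z < ?y" "?y < ?x" using ne by linarith
  then show "hecke_op i (hecke_op (Suc i) (hecke_op i (ket b))) = hecke_op (Suc i) (hecke_op i (hecke_op (Suc i) (ket b)))"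
    by cases (auto simp: b hecke_op_ket position_swap_at tr lin_simps swap_at_braid add_ac)
qed (simp_all add: lin_simps algebra_simps)

lemma prepend_prepend: "i \<noteq> j \<Longrightarrow> prepend i l (prepend j l' m) = prepend j l' (prepend i l m)"
  by (induct m rule: ket_induct) (auto simp: lin_simps prepend_ket fun_upd_twist)

lemma prepend_hecke_op: "hecke_op i (prepend j l m) = prepend j l (hecke_op i m)"
  by (induct m rule: ket_induct) (auto simp: prepend_ket hecke_op_ket lin_simps)

text \<open>
  With \<open>flip\<close>, \<open>kappa\<close> and \<open>tpow\<close> the two letters are treated alike: \<open>tpow l T\<close> is \<open>\<tau>\<close>, which is \<open>T\<close> for
  \<open>LX\<close> and \<open>T - h\<close>, that is \<open>T\<^sup>-\<^sup>1\<close>, for \<open>LY\<close>; its inverse is \<open>tpow (flip l) T\<close>.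
\<close>
fun flip :: "letter \<Rightarrow> letter" where
  "flip LX = LY"
| "flip LY = LX"

fun kappa :: "letter \<Rightarrow> K'" where
  "kappa LX = h"
| "kappa LY = - h"

lemma flip_flip [simp]: "flip (flip l) = l" by (cases l) auto
lemma flip_neq [simp]: "flip l \<noteq> l" "l \<noteq> flip l" by (cases l; simp)+
lemma neq_flip: "l \<noteq> m \<longleftrightarrow> m = flip l" by (cases l; cases m; simp)
lemma kappa_flip [simp]: "kappa (flip l) = - kappa l" by (cases l) auto

fun tpow :: "letter \<Rightarrow> (std_space \<Rightarrow> std_space) \<Rightarrow> std_space \<Rightarrow> std_space" where
  "tpow LX F v = F v"
| "tpow LY F v = F v - scale h v"

text \<open>
  The action of \<open>T\<^sub>i\<close> (first component) and of the letters on strand \<open>i + 1\<close> (second component) on basis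
  vectors with \<open>n\<close> letters on strands \<open>i\<close> and \<open>i + 1\<close>. With \<open>a = Z\<^sub>i\<close> (prepending to strand \<open>i\<close>) and \<open>b = Z\<^sub>i\<^sub>+\<^sub>1\<close>, the
  clauses are \<open>\<tau>\<^sup>-\<^sup>1 a = b \<tau>\<close>; \<open>\<tau> b = a \<tau>\<^sup>-\<^sup>1\<close> where strand \<open>i\<close> is empty, so that \<open>b\<close> prepends to strand \<open>i + 1\<close>;
  and the exchange rule for \<open>b a\<close>. They are solved for \<open>T\<close> by means of \<open>\<tau> - \<tau>\<^sup>-\<^sup>1 = \<kappa>\<close>, whence the correction
  terms that occur for one of the letters only. The value \<open>0\<close> is a default: with \<open>n + 1\<close> letters, not both words
  are empty.
\<close>
primrec strand_ops :: "nat \<Rightarrow> nat \<Rightarrow> (index \<Rightarrow> std_space) \<times> (letter \<Rightarrow> index \<Rightarrow> std_space)" where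
  "strand_ops i 0 = (\<lambda>b. hecke_op i (ket b), \<lambda>l b. prepend (Suc i) l (ket b))"
| "strand_ops i (Suc n) =
    (let T = lin (fst (strand_ops i n)); B = (\<lambda>l. lin (snd (strand_ops i n) l)) in
     (\<lambda>(u, f). case u i of
         l # p \<Rightarrow> (let v = ket (u(i := p), f) in
            B l (tpow l T v) + (case l of LX \<Rightarrow> scale h (prepend i l v) | LY \<Rightarrow> 0))
       | [] \<Rightarrow> (case u (Suc i) of
           l # q \<Rightarrow> (let v = ket (u(Suc i := q), f) in
             prepend i l (tpow (flip l) T v) + (case l of LX \<Rightarrow> 0 | LY \<Rightarrow> scale h (prepend (Suc i) l v)))
         | [] \<Rightarrow> 0),
      \<lambda>l (u, f). case u i of
         [] \<Rightarrow> prepend (Suc i) l (ket (u, f))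
       | m # p \<Rightarrow> (let v = ket (u(i := p), f) in
           prepend i m (B l v) + (if l = m then 0 else scale (kappa l) (prepend i m (prepend i l (tpow (flip l) T v)))))))"

definition deg2 :: "nat \<Rightarrow> index \<Rightarrow> nat" where
  "deg2 i b = length (fst b i) + length (fst b (Suc i))"

definition opT :: "nat \<Rightarrow> std_space \<Rightarrow> std_space" where
  "opT i = lin (\<lambda>b. fst (strand_ops i (deg2 i b)) b)"

definition opB :: "nat \<Rightarrow> letter \<Rightarrow> std_space \<Rightarrow> std_space" where
  "opB i l = lin (\<lambda>b. snd (strand_ops i (deg2 i b)) l b)"

abbreviation tau :: "nat \<Rightarrow> letter \<Rightarrow> std_space \<Rightarrow> std_space" where "tau i l \<equiv> tpow l (opT i)"
abbreviation taui :: "nat \<Rightarrow> letter \<Rightarrow> std_space \<Rightarrow> std_space" where "taui i l \<equiv> tpow (flip l) (opT i)"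

lemma linop_opT [simp]: "linop (opT i)" and linop_opB [simp]: "linop (opB i l)"
  by (simp_all add: opT_def opB_def)
lemma linop_tpow [simp]: "linop F \<Longrightarrow> linop (tpow l F)"
  by (cases l) (simp_all add: linop_def scale_add scale_diff algebra_simps)

lemmas T_lin [lin_simps] = linop_simps[OF linop_opT]
lemmas B_lin [lin_simps] = linop_simps[OF linop_opB]
lemmas tpow_lin [lin_simps] = linop_simps[OF linop_tpow[OF linop_opT]]

text \<open>
  The number of letters on strands \<open>i\<close> and \<open>i + 1\<close> together with the words on all other strands, which
  \<open>opT i\<close> and \<open>opB i l\<close> leave alone.
\<close>
definition loc2 :: "nat \<Rightarrow> (nat \<Rightarrow> letter list) \<Rightarrow> nat \<Rightarrow> index \<Rightarrow> bool" where
  "loc2 i u0 n b \<longleftrightarrow> deg2 i b = n \<and> (\<forall>j. j \<noteq> i \<longrightarrow> j \<noteq> Suc i \<longrightarrow> fst b j = u0 j)"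

lemma supported_tpow: "(\<And>v. supported P v \<Longrightarrow> supported P (F v)) \<Longrightarrow> supported P v \<Longrightarrow> supported P (tpow l F v)"
  by (cases l) (auto intro!: supported_intros)

lemma loc2_prepend: "j = i \<or> j = Suc i \<Longrightarrow> supported (loc2 i u0 n) m \<Longrightarrow> supported (loc2 i u0 (Suc n)) (prepend j l m)"
  by (rule supported_linop[of "prepend j l" "loc2 i u0 n"]) (auto simp: prepend_ket loc2_def deg2_def)

lemma loc2_hecke_op: "supported (loc2 i u0 n) m \<Longrightarrow> supported (loc2 i u0 n) (hecke_op j m)"
  by (rule supported_linop[of "hecke_op j" "loc2 i u0 n"])
    (auto simp: hecke_op_ket loc2_def deg2_def intro!: supported_intros)

lemma strand_ops_loc2:
  "loc2 i u0 n b \<Longrightarrow> supported (loc2 i u0 n) (fst (strand_ops i n) b) \<and> supported (loc2 i u0 (Suc n)) (snd (strand_ops i n) l b)"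
proof (induct n arbitrary: b l)
  case 0
  then show ?case
    by (auto intro!: loc2_prepend loc2_hecke_op)
next
  case (Suc n)
  obtain u f where b: "b = (u, f)" by (cases b)
  have opT: "supported (loc2 i u0 n) (lin (fst (strand_ops i n)) v)" if "supported (loc2 i u0 n) v" for v
    by (rule supported_linop[of "lin (fst (strand_ops i n))" "loc2 i u0 n"]) (auto simp: Suc(1) that)
  have opB: "supported (loc2 i u0 (Suc n)) (lin (snd (strand_ops i n) l) v)" if "supported (loc2 i u0 n) v" for v l
    by (rule supported_linop[of "lin (snd (strand_ops i n) l)" "loc2 i u0 n"]) (auto simp: Suc(1) that)
  have loc: "loc2 i u0 (Suc n) (u, f)" using Suc(2) by (simp add: b)
  show ?case
  proof (cases "u i")
    case (Cons m p)
    have "loc2 i u0 n (u(i := p), f)"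
      using loc Cons by (auto simp: loc2_def deg2_def)
    then have v: "supported (loc2 i u0 n) (ket (u(i := p), f))" by simp
    show ?thesis
      unfolding b using v Cons
      by (cases m; cases l) (auto simp: Let_def Suc(1) intro!: supported_intros loc2_prepend opB opT)
  next
    case Nil
    have "supported (loc2 i u0 (Suc n)) (fst (strand_ops i (Suc n)) (u, f))"
    proof (cases "u (Suc i)")
      case (Cons m p)
      have "loc2 i u0 n (u(Suc i := p), f)"
        using loc Cons Nil by (auto simp: loc2_def deg2_def)
      then have v: "supported (loc2 i u0 n) (ket (u(Suc i := p), f))" by simp
      show ?thesis
        using v Cons Nil by (cases m) (auto simp: Let_def Suc(1) intro!: supported_intros loc2_prepend opT)
    qed (simp add: Nil Let_def)
    moreover have "supported (loc2 i u0 (Suc (Suc n))) (prepend (Suc i) l (ket (u, f)))"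
      using loc by (intro loc2_prepend) auto
    ultimately show ?thesis using Nil by (simp add: b Let_def)
  qed
qed

lemma lin_strand_ops:
  assumes "supported (\<lambda>b. deg2 i b = n) v"
  shows "lin (fst (strand_ops i n)) v = opT i v" "lin (snd (strand_ops i n) l) v = opB i l v"
  using assms unfolding opT_def opB_def by (auto intro!: lin_cong simp: supported_def)

lemma loc2_T: "supported (loc2 i u0 n) m \<Longrightarrow> supported (loc2 i u0 n) (opT i m)"
  by (rule supported_linop[of "opT i" "loc2 i u0 n"]) (use strand_ops_loc2 in \<open>auto simp: opT_def loc2_def\<close>)

lemma loc2_B: "supported (loc2 i u0 n) m \<Longrightarrow> supported (loc2 i u0 (Suc n)) (opB i l m)"
  by (rule supported_linop[of "opB i l" "loc2 i u0 n"]) (use strand_ops_loc2 in \<open>auto simp: opB_def loc2_def\<close>)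

lemma deg2_T: "supported (\<lambda>b. deg2 i b = n) m \<Longrightarrow> supported (\<lambda>b. deg2 i b = n) (opT i m)"
proof (rule supported_linop[of "opT i" "\<lambda>b. deg2 i b = n"])
  fix b assume "deg2 i b = n"
  then show "supported (\<lambda>b. deg2 i b = n) (opT i (ket b))"
    using loc2_T[of i "fst b" n "ket b"] by (auto simp: loc2_def elim!: supported_mono)
qed auto

lemma tau_taui: "tau i l v = taui i l v + scale (kappa l) v"
  by (cases l) (simp_all add: scale_minus)

lemma tpow_cong: "F v = G v \<Longrightarrow> tpow l F v = tpow l G v"
  by (cases l) simp_all

lemma taui_prepend: "taui i l (prepend i l v) = opB i l (tau i l v)"
proof (induct v rule: ket_induct)
  case (ket b)
  obtain u f where b: "b = (u, f)" by (cases b)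
  let ?n = "deg2 i b"
  have "deg2 i (u(i := l # u i), f) = Suc ?n" by (simp add: b deg2_def)
  moreover have "supported (\<lambda>b. deg2 i b = ?n) (tau i l (ket b))"
    by (auto intro!: supported_tpow deg2_T)
  ultimately show "taui i l (prepend i l (ket b)) = opB i l (tau i l (ket b))"
    by (cases l) (simp_all add: b prepend_ket opT_def[of i] Let_def lin_strand_ops[unfolded opT_def[of i]] lin_simps)
qed (simp_all add: lin_simps algebra_simps)

lemma B_prepend: "opB i l (prepend i m v) = prepend i m (opB i l v) +
   (if l = m then 0 else scale (kappa l) (prepend i m (prepend i l (taui i l v))))"
proof (induct v rule: ket_induct)
  case (ket b)
  obtain u f where b: "b = (u, f)" by (cases b)
  let ?n = "deg2 i b"
  have n: "deg2 i (u(i := m # u i), f) = Suc ?n" by (simp add: b deg2_def)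
  have *: "tpow (flip l) (lin (fst (strand_ops i ?n))) (ket b) = taui i l (ket b)"
    by (rule tpow_cong) (simp add: opT_def)
  have **: "snd (strand_ops i (deg2 i b)) l b = opB i l (ket b)" by (simp add: opB_def)
  have "opB i l (prepend i m (ket b)) = snd (strand_ops i (Suc ?n)) l (u(i := m # u i), f)"
    using n by (simp add: opB_def b prepend_ket del: strand_ops.simps)
  also have "\<dots> = prepend i m (opB i l (ket b)) + (if l = m then 0 else scale (kappa l) (prepend i m (prepend i l (taui i l (ket b)))))"
    using * ** by (simp add: b Let_def)
  finally show "opB i l (prepend i m (ket b)) = prepend i m (opB i l (ket b)) + (if l = m then 0 else scale (kappa l) (prepend i m (prepend i l (taui i l (ket b)))))" .
qed (simp_all add: lin_simps algebra_simps)

definition vacant :: "nat \<Rightarrow> std_space \<Rightarrow> bool" where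
  "vacant i = supported (\<lambda>b. fst b i = [])"

lemma B_vacant: "vacant i v \<Longrightarrow> opB i l v = prepend (Suc i) l v"
  unfolding vacant_def
proof (induct rule: supported_induct)
  case (ket b)
  then show "opB i l (ket b) = prepend (Suc i) l (ket b)"
    by (cases b; cases "deg2 i b") (auto simp: opB_def Let_def)
qed (simp_all add: lin_simps)

lemma T_vacant: "vacant i v \<Longrightarrow> vacant (Suc i) v \<Longrightarrow> opT i v = hecke_op i v"
proof -
  assume "vacant i v" "vacant (Suc i) v"
  then have "supported (\<lambda>b. fst b i = [] \<and> fst b (Suc i) = []) v" by (auto simp: supported_def vacant_def)
  then show ?thesis
    by (induct rule: supported_induct) (auto simp: lin_simps, simp_all add: opT_def deg2_def)
qed

lemma tau_prepend_Suc: "vacant i v \<Longrightarrow> tau i l (prepend (Suc i) l v) = prepend i l (taui i l v)"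
  unfolding vacant_def
proof (induct rule: supported_induct)
  case a: (ket b)
  obtain u f where b: "b = (u, f)" by (cases b)
  let ?n = "deg2 i b"
  have "deg2 i (u(Suc i := l # u (Suc i)), f) = Suc ?n" by (simp add: b deg2_def)
  then show "tau i l (prepend (Suc i) l (ket b)) = prepend i l (taui i l (ket b))"
    using a by (cases l) (simp_all add: b prepend_ket opT_def[of i] Let_def lin_simps)
qed (simp_all add: lin_simps algebra_simps)

section \<open>Two adjacent strands\<close>

lemma ket_cases2:
  fixes b :: index
  obtains (first) m b' where "ket b = prepend i m (ket b')" "deg2 i b = Suc (deg2 i b')"
  | (second) m b' where "ket b = prepend (Suc i) m (ket b')" "deg2 i b = Suc (deg2 i b')"
      "fst b' i = []" "fst b i = []"
  | (none) "fst b i = []" "fst b (Suc i) = []"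
proof -
  obtain u f where b: "b = (u, f)" by (cases b)
  show thesis
  proof (cases "u i")
    case (Cons m p)
    then have "u(i := m # p) = u" by auto
    with Cons show thesis
      by (intro first[of m "(u(i := p), f)"]) (simp_all add: b prepend_ket deg2_def)
  next
    case Nil
    show thesis
    proof (cases "u (Suc i)")
      case (Cons m p)
      then have "u(Suc i := m # p) = u" by auto
      with Cons Nil show thesis
        by (intro second[of m "(u(Suc i := p), f)"]) (simp_all add: b prepend_ket deg2_def)
    qed (use Nil none b in simp)
  qed
qed

abbreviation homog2 :: "nat \<Rightarrow> nat \<Rightarrow> std_space \<Rightarrow> bool" where
  "homog2 i n \<equiv> supported (\<lambda>b. deg2 i b = n)"

lemma vacant_ket: "vacant i (ket b) \<longleftrightarrow> fst b i = []"
  by (simp add: vacant_def)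

lemma tau_prepend: "tau i l (prepend i l v) = opB i l (tau i l v) + scale (kappa l) (prepend i l v)"
  using tau_taui[of l i "prepend i l v"] by (simp add: taui_prepend)

lemma taui_tau: "taui i l v = tau i l v - scale (kappa l) v"
  using tau_taui[of l i v] by simp

lemma tpow_commute: "tau i l (taui i l v) = taui i l (tau i l v)"
  by (cases l) (simp_all add: lin_simps)

text \<open>
  Invertibility of \<open>\<tau>\<close> and the rule \<open>\<tau> b = a \<tau>\<^sup>-\<^sup>1\<close>, which the definition grants only where strand \<open>i\<close> is
  empty. Both are needed for fewer letters to push \<open>\<tau>\<close> through a letter \<open>a\<close> at the front.
\<close>
lemma two_strands:
  "homog2 i n v \<Longrightarrow> tau i l (taui i l v) = v"
  "homog2 i n v \<Longrightarrow> tau i l (opB i l v) = prepend i l (taui i l v)"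
proof (induct n arbitrary: l v rule: less_induct)
  case (less n)
  have inv: "tau i l (taui i l v) = v" "taui i l (tau i l v) = v"
    if "homog2 i k v" "k < n" for k l v
    using less(1)[OF that(2,1), of l] by (simp_all flip: tpow_commute)
  have R2: "tau i l (opB i l v) = prepend i l (taui i l v)" if "homog2 i k v" "k < n" for k l v
    using less(2)[OF that(2,1)] .
  have tauk: "homog2 i (deg2 i b) (tau i l (ket b))" for l b
    by (intro supported_tpow deg2_T) auto
  {
    fix l v assume "homog2 i n v"
    then show "tau i l (taui i l v) = v"
    proof (induct rule: supported_induct)
      case (ket b)
      show ?case
      proof (cases b rule: ket_cases2[where i = i])
        case (first m b')
        then have lt: "deg2 i b' < n" using ket by simp
        have "tau i m (taui i m (prepend i m (ket b'))) = prepend i m (ket b')"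
          using lt by (simp add: taui_prepend R2[OF tauk] inv[of "deg2 i b'"])
        moreover from this have "taui i m (tau i m (prepend i m (ket b'))) = prepend i m (ket b')"
          by (simp add: tpow_commute)
        ultimately show ?thesis
          using first by (cases "m = l") (auto simp: neq_flip)
      next
        case (second m b')
        then have lt: "deg2 i b' < n" using ket by simp
        have e: "vacant i (ket b')" using second by (simp add: vacant_ket)
        have "taui i m (tau i m (prepend (Suc i) m (ket b'))) = prepend (Suc i) m (ket b')"
          using lt e by (simp add: taui_prepend tau_prepend_Suc inv[of "deg2 i b'"] B_vacant)
        moreover from this have "tau i m (taui i m (prepend (Suc i) m (ket b'))) = prepend (Suc i) m (ket b')"
          by (simp add: tpow_commute)
        ultimately show ?thesis
          using second by (cases "m = l") (auto simp: neq_flip)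
      next
        case none
        have 1: "opT i (ket b) = hecke_op i (ket b)"
          using none by (simp add: T_vacant vacant_ket)
        have "vacant i (hecke_op i (ket b))" "vacant (Suc i) (hecke_op i (ket b))"
          using none by (cases b; auto simp: vacant_def hecke_op_ket intro!: supported_intros)+
        then have "opT i (hecke_op i (ket b)) = hecke_op i (hecke_op i (ket b))"
          by (simp add: T_vacant)
        then show ?thesis
          by (cases l) (simp_all add: 1 lin_simps hecke_op_quad)
      qed
    qed (simp_all add: lin_simps)
  } note inv_n = this
  {
    fix l v assume "homog2 i n v"
    then show "tau i l (opB i l v) = prepend i l (taui i l v)"
    proof (induct rule: supported_induct)
      case (ket b)
      show ?case
      proof (cases "fst b i")
        case Nil
        then show ?thesis by (simp add: B_vacant vacant_ket tau_prepend_Suc)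
      next
        case (Cons m p)
        then obtain m b' where first: "ket b = prepend i m (ket b')" "deg2 i b = Suc (deg2 i b')"
          by (cases b rule: ket_cases2[where i = i]) auto
        let ?v = "ket b' :: std_space"
        have lt: "deg2 i b' < n" using first ket by simp
        have R2v: "tau i l (opB i l ?v) = prepend i l (taui i l ?v)" for l
          using lt by (simp add: R2)
        have invv: "tau i l (taui i l ?v) = ?v" "taui i l (tau i l ?v) = ?v" for l
          using lt by (simp_all add: inv[of "deg2 i b'"])
        show ?thesis
        proof (cases "m = l")
          case True
          have "tau i l (opB i l (prepend i l ?v)) = tau i l (prepend i l (opB i l ?v))"
            by (simp add: B_prepend)
          also have "\<dots> = opB i l (prepend i l (taui i l ?v)) + scale (kappa l) (prepend i l (opB i l ?v))"
            by (simp add: tau_prepend R2v)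
          also have "\<dots> = prepend i l (opB i l (tau i l ?v))"
            by (simp add: B_prepend taui_tau lin_simps)
          finally show ?thesis by (simp add: first True taui_prepend)
        next
          case False
          then have m: "m = flip l" by (simp add: neq_flip)
          have "tau i l (opB i l (prepend i m ?v)) =
             tau i (flip m) (prepend i m (opB i l ?v)) + scale (kappa l) (tau i (flip m) (prepend i m (prepend i l (taui i l ?v))))"
            using False by (simp add: B_prepend lin_simps m)
          also have "\<dots> = opB i m (taui i l (opB i l ?v)) + scale (kappa l) (opB i m (taui i l (prepend i l (taui i l ?v))))"
            by (simp only: taui_prepend[of m i]) (simp only: m)
          also have "\<dots> = opB i m (prepend i l (taui i l ?v)) - scale (kappa l) (opB i m (opB i l ?v))
              + scale (kappa l) (opB i m (opB i l ?v))"
            by (simp only: taui_prepend invv taui_tau[of l i "opB i l ?v"] R2v B_lin)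
          also have "\<dots> = prepend i l (opB i m (taui i l ?v)) - scale (kappa l) (prepend i l (prepend i m ?v))"
            using False by (simp add: B_prepend m invv lin_simps)
          also have "\<dots> = prepend i l (taui i l (prepend i m ?v))"
            by (simp add: m tau_prepend lin_simps)
          finally show ?thesis by (simp add: first)
        qed
      qed
    qed (simp_all add: lin_simps)
  }
qed

lemma tau_inv [simp]: "tau i l (taui i l v) = v"
proof (induct v rule: ket_induct)
  case (ket b)
  show ?case by (rule two_strands(1)[of _ "deg2 i b"]) simp
qed (simp_all add: lin_simps)

lemma taui_inv [simp]: "taui i l (tau i l v) = v"
  by (simp flip: tpow_commute)

lemma tau_B: "tau i l (opB i l v) = prepend i l (taui i l v)"
proof (induct v rule: ket_induct)
  case (ket b)
  show ?case by (rule two_strands(2)[of _ "deg2 i b"]) simp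
qed (simp_all add: lin_simps)

lemma T_quad: "opT i (opT i v) = v + scale h (opT i v)"
  using tau_inv[of LX i v] by (simp add: lin_simps algebra_simps)

lemma commute_tpow: "(\<And>v. F (opT i v) = opT i (F v)) \<Longrightarrow> linop F \<Longrightarrow> F (tpow l (opT i) v) = tpow l (opT i) (F v)"
  by (cases l) (simp_all add: linop_diff[of F] linop_scale[of F])

lemma T_tpow: "opT i v = tpow l (opT i) v + scale (if l = LX then 0 else h) v"
  by (cases l) simp_all

text \<open>
  Whatever commutes with the ingredients of the recursion that defines \<open>opT i\<close> and \<open>opB i\<close>, and respects
  its case distinctions, commutes with these operators. The commutations between distant strands are
  instances.
\<close>
lemma commute_T_B:
  assumes F: "linop F"
    and a: "\<And>l v. F (prepend i l v) = prepend i l (F v)"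
    and a2: "\<And>l v. F (prepend (Suc i) l v) = prepend (Suc i) l (F v)"
    and h: "\<And>v. F (hecke_op i v) = hecke_op i (F v)"
    and e: "\<And>v. vacant i v \<Longrightarrow> vacant i (F v)" "\<And>v. vacant (Suc i) v \<Longrightarrow> vacant (Suc i) (F v)"
  shows "homog2 i n v \<Longrightarrow> F (opT i v) = opT i (F v)" "homog2 i n v \<Longrightarrow> F (opB i l v) = opB i l (F v)"
proof (induct n arbitrary: l v rule: less_induct)
  case (less n)
  note [lin_simps] = linop_simps[OF F]
  have opT: "F (tpow l (opT i) v) = tpow l (opT i) (F v)" if "homog2 i k v" "k < n" for k v l
    using less(1)[OF that(2,1)] by (cases l) (simp_all add: lin_simps)
  have opB: "F (opB i l v) = opB i l (F v)" if "homog2 i k v" "k < n" for k v l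
    using less(2)[OF that(2,1)] .
  have tauk: "homog2 i (deg2 i b) (tau i l (ket b))" for l b
    by (intro supported_tpow deg2_T) auto
  {
    fix v assume "homog2 i n v"
    then show "F (opT i v) = opT i (F v)"
    proof (induct rule: supported_induct)
      case (ket b)
      show ?case
      proof (cases b rule: ket_cases2[where i = i])
        case (first m b')
        then have lt: "deg2 i b' < n" using ket by simp
        have "F (taui i m (ket b)) = taui i m (F (ket b))"
          unfolding first(1) a taui_prepend using lt
          by (simp add: opB[OF tauk] opT[of "deg2 i b'"])
        then show ?thesis
          by (simp add: T_tpow[of i _ "flip m"] lin_simps)
      next
        case (second m b')
        then have lt: "deg2 i b' < n" using ket by simp
        have em: "vacant i (ket b')" using second by (simp add: vacant_ket)
        have "F (tau i m (ket b)) = tau i m (F (ket b))"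
          unfolding second(1) a2 using lt
          by (simp add: tau_prepend_Suc[OF em] tau_prepend_Suc[OF e(1)[OF em]] a opT[of "deg2 i b'"])
        then show ?thesis
          by (simp add: T_tpow[of i _ m] lin_simps)
      next
        case none
        then show ?thesis
          using e[of "ket b"] by (simp add: T_vacant vacant_ket h)
      qed
    qed (simp_all add: lin_simps)
  next
    fix v l assume "homog2 i n v"
    then show "F (opB i l v) = opB i l (F v)"
    proof (induct rule: supported_induct)
      case (ket b)
      show ?case
      proof (cases "fst b i")
        case Nil
        then show ?thesis using e[of "ket b"] by (simp add: B_vacant vacant_ket a2)
      next
        case (Cons m p)
        then obtain m b' where first: "ket b = prepend i m (ket b')" "deg2 i b = Suc (deg2 i b')"
          by (cases b rule: ket_cases2[where i = i]) auto
        then have lt: "deg2 i b' < n" using ket by simp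
        show ?thesis
          unfolding first(1) a B_prepend using lt
          by (simp add: lin_simps a opB[of "deg2 i b'"] opT[of "deg2 i b'"])
      qed
    qed (simp_all add: lin_simps)
  }
qed

lemma commute_TB:
  assumes F: "linop F"
    and "\<And>l v. F (prepend i l v) = prepend i l (F v)"
    and "\<And>l v. F (prepend (Suc i) l v) = prepend (Suc i) l (F v)"
    and "\<And>v. F (hecke_op i v) = hecke_op i (F v)"
    and "\<And>v. vacant i v \<Longrightarrow> vacant i (F v)" "\<And>v. vacant (Suc i) v \<Longrightarrow> vacant (Suc i) (F v)"
  shows "F (opT i v) = opT i (F v)" "F (opB i l v) = opB i l (F v)"
proof -
  note * = commute_T_B[OF assms]
  note [lin_simps] = linop_simps[OF F]
  show "F (opT i v) = opT i (F v)"
  proof (induct v rule: ket_induct)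
    case (ket b) show ?case by (rule *(1)[of "deg2 i b"]) auto
  qed (simp_all add: lin_simps)
  show "F (opB i l v) = opB i l (F v)"
  proof (induct v rule: ket_induct)
    case (ket b) show ?case by (rule *(2)[of "deg2 i b"]) auto
  qed (simp_all add: lin_simps)
qed

lemma vacant_prepend: "j \<noteq> i \<Longrightarrow> vacant i v \<Longrightarrow> vacant i (prepend j l v)"
  unfolding vacant_def by (rule supported_linop[of "prepend j l" "\<lambda>b. fst b i = []"]) (auto simp: prepend_ket)

lemma vacant_hecke_op: "vacant i v \<Longrightarrow> vacant i (hecke_op j v)"
  unfolding vacant_def
  by (rule supported_linop[of "hecke_op j" "\<lambda>b. fst b i = []"]) (auto simp: hecke_op_ket intro!: supported_intros)

lemma vacant_T: "j \<noteq> i \<Longrightarrow> j \<noteq> Suc i \<Longrightarrow> vacant j v \<Longrightarrow> vacant j (opT i v)"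
  unfolding vacant_def
proof (rule supported_linop[of "opT i" "\<lambda>b. fst b j = []"])
  fix b :: index assume "j \<noteq> i" "j \<noteq> Suc i" "fst b j = []"
  then show "supported (\<lambda>b. fst b j = []) (opT i (ket b))"
    using loc2_T[of i "fst b" "deg2 i b" "ket b"] by (auto simp: loc2_def elim!: supported_mono)
qed auto

lemma vacant_B: "j \<noteq> i \<Longrightarrow> j \<noteq> Suc i \<Longrightarrow> vacant j v \<Longrightarrow> vacant j (opB i l v)"
  unfolding vacant_def
proof (rule supported_linop[of "opB i l" "\<lambda>b. fst b j = []"])
  fix b :: index assume "j \<noteq> i" "j \<noteq> Suc i" "fst b j = []"
  then show "supported (\<lambda>b. fst b j = []) (opB i l (ket b))"
    using loc2_B[of i "fst b" "deg2 i b" "ket b" l] by (auto simp: loc2_def elim!: supported_mono)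
qed auto

lemma vacant_tpow: "j \<noteq> i \<Longrightarrow> j \<noteq> Suc i \<Longrightarrow> vacant j v \<Longrightarrow> vacant j (tpow l (opT i) v)"
  using supported_tpow[of "\<lambda>b. fst b j = []" "opT i"] vacant_T[of j i] by (simp add: vacant_def)

lemma T_prepend_far: "j \<noteq> i \<Longrightarrow> j \<noteq> Suc i \<Longrightarrow> opT i (prepend j l v) = prepend j l (opT i v)"
  by (rule commute_TB(1)[symmetric]) (auto simp: prepend_prepend prepend_hecke_op intro!: vacant_prepend)

lemma T_hecke_op_far: "i + 1 < j \<or> j + 1 < i \<Longrightarrow> opT i (hecke_op j v) = hecke_op j (opT i v)"
  by (rule commute_TB(1)[symmetric]) (auto simp: prepend_hecke_op hecke_op_far intro!: vacant_hecke_op)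

lemma T_T_far: "i + 1 < j \<or> j + 1 < i \<Longrightarrow> opT i (opT j v) = opT j (opT i v)"
  by (rule commute_TB(1)) (auto simp: T_prepend_far T_hecke_op_far intro!: vacant_T)

lemma tpow_prepend_far: "j \<noteq> i \<Longrightarrow> j \<noteq> Suc i \<Longrightarrow> tpow m (opT i) (prepend j l v) = prepend j l (tpow m (opT i) v)"
  by (rule commute_tpow[symmetric]) (auto simp: T_prepend_far)

section \<open>Three adjacent strands and the braid relation\<close>

definition deg3 :: "nat \<Rightarrow> index \<Rightarrow> nat" where
  "deg3 i b = length (fst b i) + length (fst b (Suc i)) + length (fst b (Suc (Suc i)))"

abbreviation homog3 :: "nat \<Rightarrow> nat \<Rightarrow> std_space \<Rightarrow> bool" where
  "homog3 i n \<equiv> supported (\<lambda>b. deg3 i b = n)"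

lemma homog3_T: "homog3 i n v \<Longrightarrow> homog3 i n (opT i v)" "homog3 i n v \<Longrightarrow> homog3 i n (opT (Suc i) v)"
proof -
  show "homog3 i n (opT i v)" if "homog3 i n v"
    using linop_opT _ that
  proof (rule supported_linop)
    fix b assume b: "deg3 i b = n"
    show "homog3 i n (opT i (ket b))"
      using loc2_T[of i "fst b" "deg2 i b" "ket b"] 
      by (auto simp: loc2_def deg2_def deg3_def b[symmetric] elim!: supported_mono)
  qed
  show "homog3 i n (opT (Suc i) v)" if "homog3 i n v"
    using linop_opT _ that
  proof (rule supported_linop)
    fix b assume b: "deg3 i b = n"
    show "homog3 i n (opT (Suc i) (ket b))"
      using loc2_T[of "Suc i" "fst b" "deg2 (Suc i) b" "ket b"] 
      by (auto simp: loc2_def deg2_def deg3_def b[symmetric] elim!: supported_mono)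
  qed
qed

lemma homog3_tpow: "homog3 i n v \<Longrightarrow> homog3 i n (tpow l (opT i) v)"
   "homog3 i n v \<Longrightarrow> homog3 i n (tpow l (opT (Suc i)) v)"
  by (intro supported_tpow homog3_T; assumption)+

text \<open>The letters on strand \<open>i + 2\<close>, seen from the strands \<open>i\<close>, \<open>i + 1\<close>, \<open>i + 2\<close>.\<close>
definition opC :: "nat \<Rightarrow> letter \<Rightarrow> std_space \<Rightarrow> std_space" where
  "opC i l v = taui (Suc i) l (opB i l (taui (Suc i) l v))"

lemma linop_opC: "linop (opC i l)"
  by (simp add: linop_def opC_def lin_simps)
lemmas opC_lin [lin_simps] = linop_simps[OF linop_opC]

lemma opC_tau: "taui (Suc i) l (opB i l v) = opC i l (tau (Suc i) l v)"
  by (simp add: opC_def)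
lemma tau_opC: "tau (Suc i) l (opC i l v) = opB i l (taui (Suc i) l v)"
  by (simp add: opC_def)

lemma opC_prepend: "opC i l (prepend i m v) = prepend i m (opC i l v) +
   (if l = m then 0 else scale (kappa l) (prepend i m (prepend i l (taui (Suc i) l (taui i l (taui (Suc i) l v))))))"
  by (simp add: opC_def tpow_prepend_far B_prepend lin_simps)

text \<open>
  Where strand \<open>i\<close> is empty, the letters on strands \<open>i + 1\<close> and \<open>i + 2\<close> act as in the system formed by these
  two strands alone. This is the base of the induction on three strands.
\<close>
lemma opC_vacant: "vacant i v \<Longrightarrow> opC i l v = opB (Suc i) l v"
  using taui_prepend[of l "Suc i" "taui (Suc i) l v"]
  by (simp add: opC_def B_vacant vacant_tpow)

lemma ket_cases3:
  fixes b :: index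
  obtains (first) m b' where "ket b = prepend i m (ket b')" "deg3 i b = Suc (deg3 i b')"
  | (second) m b' where "ket b = opB i m (ket b')" "deg3 i b = Suc (deg3 i b')" "fst b i = []"
  | (third) m b' where "ket b = opC i m (ket b')" "deg3 i b = Suc (deg3 i b')" "fst b i = []" "fst b (Suc i) = []"
  | (none) "fst b i = []" "fst b (Suc i) = []" "deg3 i b = 0"
proof (cases b rule: ket_cases2[where i = i])
  assume first: thesis if "ket b = prepend i m (ket b')" "deg3 i b = Suc (deg3 i b')" for m b'
  assume second: thesis if "ket b = opB i m (ket b')" "deg3 i b = Suc (deg3 i b')" "fst b i = []" for m b'
  assume third: thesis if "ket b = opC i m (ket b')" "deg3 i b = Suc (deg3 i b')" "fst b i = []" "fst b (Suc i) = []" for m b'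
  assume none: thesis if "fst b i = []" "fst b (Suc i) = []" "deg3 i b = 0"
  {
    case 1: (first m b')
    have "b = ((fst b')(i := m # fst b' i), snd b')"
      using 1(1) by (cases b') (simp add: prepend_ket)
    then have "deg3 i b = Suc (deg3 i b')"
      by (auto simp: deg3_def fun_eq_iff)
    with 1 show thesis by (intro first)
  next
    case 2: (second m b')
    have "b = ((fst b')(Suc i := m # fst b' (Suc i)), snd b')"
      using 2(1) by (cases b') (simp add: prepend_ket)
    then have "deg3 i b = Suc (deg3 i b')"
      by (auto simp: deg3_def fun_eq_iff)
    with 2 show thesis by (intro second[of m b']) (simp_all add: B_vacant vacant_ket)
  next
    case e: none
    obtain u f where b: "b = (u, f)" by (cases b)
    show thesis
    proof (cases "u (Suc (Suc i))")
      case Nil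
      then show thesis using e none by (simp add: b deg3_def)
    next
      case (Cons m p)
      let ?b = "(u(Suc (Suc i) := p), f)"
      have "u(Suc (Suc i) := m # p) = u" using Cons by auto
      then have "ket b = opC i m (ket ?b)"
        using e by (simp add: opC_vacant B_vacant vacant_ket b prepend_ket)
      then show thesis
        using e Cons by (intro third[of m ?b]) (auto simp: deg3_def b)
    qed
  }
qed

text \<open>
  By the quadratic relation, the braid relation at a single vector is equivalent, at the same vector,
  to the forms in which some of the factors are inverted. Which form is useful depends on the letter at the front.
\<close>
lemma braid_tpow:
  assumes "opT i (opT j (opT i v)) = opT j (opT i (opT j v))"
  shows "tau i l (tau j l (tau i l v)) = tau j l (tau i l (tau j l v))"
  using assms by (cases l) (simp_all add: lin_simps T_quad algebra_simps)

lemma braid_mixed: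
  assumes "opT i (opT j (opT i v)) = opT j (opT i (opT j v))"
  shows "taui i l (tau j l (tau i l v)) = tau j l (tau i l (taui j l v))"
    "tau i l (tau j l (taui i l v)) = taui j l (tau i l (tau j l v))"
  using braid_tpow[OF assms, of l] by (simp_all add: taui_tau lin_simps)

lemma braid_from:
  assumes "tau i l (tau j l (tau i l v)) = tau j l (tau i l (tau j l v))"
  shows "opT i (opT j (opT i v)) = opT j (opT i (opT j v))"
  using assms by (cases l) (simp_all add: lin_simps T_quad algebra_simps)

lemma braid_from_mixed:
  assumes "tau i l (tau j l (taui i l v)) = taui j l (tau i l (tau j l v))"
  shows "opT i (opT j (opT i v)) = opT j (opT i (opT j v))"
  using assms by (intro braid_from[where i = i and j = j and l = l]) (simp_all add: taui_tau lin_simps)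

lemma commute_opC_from:
  assumes "tpow m (opT i) (opC i l w) = opC i l (tpow m (opT i) w)"
  shows "opT i (opC i l w) = opC i l (opT i w)"
  using assms by (cases m) (simp_all add: lin_simps)

text \<open>
  The induction step on three strands. In the following, \<open>a\<close>, \<open>b\<close> and \<open>c\<close> are the letters \<open>l\<close> on strands \<open>i\<close>,
  \<open>i + 1\<close> and \<open>i + 2\<close>, \<open>\<sigma>\<^sub>1\<close> and \<open>\<sigma>\<^sub>2\<close> are the powers \<open>\<tau>\<close> for \<open>l\<close> of \<open>T\<^sub>i\<close> and \<open>T\<^sub>i\<^sub>+\<^sub>1\<close>, and a prime marks the same
  for the other letter or the inverse of \<open>\<sigma>\<close>. Vectors with \<open>k + 1\<close> letters are sums of \<open>a v\<close>, of \<open>b v\<close> with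
  strand \<open>i\<close> empty, and of \<open>c v\<close> with strands \<open>i\<close> and \<open>i + 1\<close> empty, for \<open>v\<close> with \<open>k\<close> letters. For the braid relation at each
  of them there is a form in which every \<open>\<sigma>\<close> slides through the letter by \<open>\<sigma>\<^sub>1' a = b \<sigma>\<^sub>1\<close>, \<open>\<sigma>\<^sub>1 b = a \<sigma>\<^sub>1'\<close>,
  \<open>\<sigma>\<^sub>2' b = c \<sigma>\<^sub>2\<close>, \<open>\<sigma>\<^sub>2 c = b \<sigma>\<^sub>2'\<close> and \<open>\<sigma>\<^sub>1 c = c \<sigma>\<^sub>1\<close> without correction terms.
\<close>

context
  fixes i k :: nat
  assumes br: "\<And>v. homog3 i k v \<Longrightarrow> opT i (opT (Suc i) (opT i v)) = opT (Suc i) (opT i (opT (Suc i) v))"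
    and commute: "\<And>l v. homog3 i k v \<Longrightarrow> opT i (opC i l v) = opC i l (opT i v)"
    and D: "\<And>l m v. homog3 i k v \<Longrightarrow> opC i l (opB i m v) = opB i m (opC i l v) +
      (if l = m then 0 else scale (kappa l) (opB i m (opB i l (taui (Suc i) l v))))"
begin

lemma commute_opC: "homog3 i k v \<Longrightarrow> tpow m (opT i) (opC i l v) = opC i l (tpow m (opT i) v)"
  using commute[of v l] by (cases m) (simp_all add: lin_simps)

lemma braid_first:
  assumes v: "homog3 i k v"
  shows "opT i (opT (Suc i) (opT i (prepend i l v))) = opT (Suc i) (opT i (opT (Suc i) (prepend i l v)))"
proof (rule braid_from[where l = "flip l"])
  have "taui i l (taui (Suc i) l (taui i l (prepend i l v))) = opC i l (taui i l (tau (Suc i) l (tau i l v)))"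
    by (simp only: taui_prepend opC_tau commute_opC homog3_tpow v)
  also have "\<dots> = opC i l (tau (Suc i) l (tau i l (taui (Suc i) l v)))"
    by (simp only: braid_mixed(1)[OF br[OF v]])
  also have "\<dots> = taui (Suc i) l (taui i l (taui (Suc i) l (prepend i l v)))"
    by (simp add: taui_prepend opC_tau tpow_prepend_far)
  finally show "taui i l (taui (Suc i) l (taui i l (prepend i l v))) =
    taui (Suc i) l (taui i l (taui (Suc i) l (prepend i l v)))" .
qed

lemma braid_second:
  assumes v: "homog3 i k v"
  shows "opT i (opT (Suc i) (opT i (opB i l v))) = opT (Suc i) (opT i (opT (Suc i) (opB i l v)))"
proof (rule braid_from_mixed[where l = "flip l"])
  have "taui i l (taui (Suc i) l (tau i l (opB i l v))) = opB i l (tau i l (taui (Suc i) l (taui i l v)))"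
    by (simp add: tau_B taui_prepend tpow_prepend_far)
  also have "\<dots> = opB i l (taui (Suc i) l (taui i l (tau (Suc i) l v)))"
    using braid_mixed(1)[OF br[OF v], of "flip l"] by simp
  also have "\<dots> = tau (Suc i) l (taui i l (taui (Suc i) l (opB i l v)))"
    by (simp only: tau_opC opC_tau commute_opC homog3_tpow v)
  finally show "taui i l (taui (Suc i) l (tpow (flip (flip l)) (opT i) (opB i l v))) =
    tpow (flip (flip l)) (opT (Suc i)) (taui i l (taui (Suc i) l (opB i l v)))" by simp
qed

lemma braid_third:
  assumes v: "homog3 i k v"
  shows "opT i (opT (Suc i) (opT i (opC i l v))) = opT (Suc i) (opT i (opT (Suc i) (opC i l v)))"
proof (rule braid_from[where l = l])
  have "tau i l (tau (Suc i) l (tau i l (opC i l v))) = prepend i l (taui i l (taui (Suc i) l (tau i l v)))"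
    by (simp only: tau_B tau_opC commute_opC homog3_tpow v)
  also have "\<dots> = prepend i l (tau (Suc i) l (taui i l (taui (Suc i) l v)))"
    using braid_mixed(2)[OF br[OF v], of "flip l"] by simp
  also have "\<dots> = tau (Suc i) l (tau i l (tau (Suc i) l (opC i l v)))"
    by (simp add: tau_opC tau_B tpow_prepend_far)
  finally show "tau i l (tau (Suc i) l (tau i l (opC i l v))) =
     tau (Suc i) l (tau i l (tau (Suc i) l (opC i l v)))" .
qed

text \<open>
  Passing \<open>\<sigma>\<^sub>1\<close> turns the exchange rule for \<open>c a'\<close> into the one for \<open>c b'\<close>: by the braid relation, it reduces
  the factor \<open>\<sigma>\<^sub>2' \<sigma>\<^sub>1' \<sigma>\<^sub>2'\<close> of the former correction term to \<open>\<sigma>\<^sub>2' \<sigma>\<^sub>1'\<close>. On \<open>b' v\<close> the two rules change places.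
\<close>
lemma commute_opC_first:
  assumes v: "homog3 i k v"
  shows "opT i (opC i l (prepend i m v)) = opC i l (opT i (prepend i m v))"
proof (rule commute_opC_from[where m = "flip m"])
  show "taui i m (opC i l (prepend i m v)) = opC i l (taui i m (prepend i m v))"
  proof (cases "l = m")
    case True
    show ?thesis
      using True by (simp add: opC_prepend taui_prepend D homog3_tpow v commute_opC)
  next
    case False
    then have m: "m = flip l" by (simp add: neq_flip)
    have "taui i m (opC i l (prepend i m v)) = taui i m (prepend i m (opC i l v)) +
       scale (kappa l) (taui i m (prepend i m (prepend i l (taui (Suc i) l (taui i l (taui (Suc i) l v))))))"
      using False by (simp add: opC_prepend lin_simps)
    also have "\<dots> = opB i m (tau i m (opC i l v)) +
       scale (kappa l) (opB i m (tau i m (prepend i l (taui (Suc i) l (taui i l (taui (Suc i) l v))))))"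
      by (simp only: taui_prepend)
    also have "\<dots> = opB i m (opC i l (tau i m v)) +
       scale (kappa l) (opB i m (opB i l (tau i l (taui (Suc i) l (taui i l (taui (Suc i) l v))))))"
      by (simp add: m commute_opC v taui_prepend)
    also have "tau i l (taui (Suc i) l (taui i l (taui (Suc i) l v))) = taui (Suc i) l (taui i l v)"
      using braid_mixed(1)[OF br[OF homog3_tpow(2)[OF v]], of "flip l" "flip l"] by simp
    also have "opB i m (opC i l (tau i m v)) + scale (kappa l) (opB i m (opB i l (taui (Suc i) l (taui i l v))))
       = opC i l (opB i m (tau i m v))"
      using False by (simp add: D homog3_tpow v m)
    finally show ?thesis by (simp add: taui_prepend)
  qed
qed

lemma commute_opC_second:
  assumes v: "homog3 i k v"
  shows "opT i (opC i l (opB i m v)) = opC i l (opT i (opB i m v))"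
proof (rule commute_opC_from[where m = m])
  show "tau i m (opC i l (opB i m v)) = opC i l (tau i m (opB i m v))"
  proof (cases "l = m")
    case True
    then show ?thesis
      by (simp add: D v tau_B opC_prepend commute_opC)
  next
    case False
    then have m: "m = flip l" by (simp add: neq_flip)
    have "tau i m (opC i l (opB i m v)) = prepend i m (opC i l (taui i m v)) +
       scale (kappa l) (prepend i m (prepend i l (taui i l (taui (Suc i) l v))))"
      using False by (simp add: D v lin_simps tau_B commute_opC) (simp add: m tau_B)
    also have "taui i l (taui (Suc i) l v) = taui (Suc i) l (taui i l (taui (Suc i) l (tau i l v)))"
      using braid_tpow[OF br[OF homog3_tpow(1)[OF v]], of "flip l" l] by simp
    also have "prepend i m (opC i l (taui i m v)) +
       scale (kappa l) (prepend i m (prepend i l (taui (Suc i) l (taui i l (taui (Suc i) l (tau i l v))))))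
       = opC i l (prepend i m (taui i m v))"
      using False by (simp add: opC_prepend m)
    finally show ?thesis by (simp add: tau_B)
  qed
qed

lemma omega:
  assumes v: "homog3 i k v"
  shows "taui (Suc i) l (taui i l (taui (Suc i) l v)) = taui i l (taui (Suc i) l (taui i l v))"
  using braid_tpow[OF br[OF v], of "flip l"] by simp

text \<open>
  With \<open>\<omega> = \<sigma>\<^sub>2' \<sigma>\<^sub>1' \<sigma>\<^sub>2'\<close>, the correction factor in the exchange rule for strands \<open>i\<close> and \<open>i + 2\<close>, this is
  \<open>\<omega> b + \<kappa> \<omega> a \<sigma>\<^sub>1' = b \<omega> + \<kappa> \<sigma>\<^sub>1' a \<omega>\<close>. Both sides are equal to \<open>b \<sigma>\<^sub>2' \<sigma>\<^sub>1' \<sigma>\<^sub>2\<close>: on the left, the terms with \<open>c\<close> cancel. It is what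
  remains of the exchange rule for \<open>c b\<close> when the two sides are sorted on \<open>a' v\<close>.
\<close>
lemma omega_B:
  assumes v: "homog3 i k v"
  shows "taui (Suc i) l (taui i l (taui (Suc i) l (opB i l v)))
      + scale (kappa l) (taui (Suc i) l (taui i l (taui (Suc i) l (prepend i l (taui i l v)))))
    = opB i l (taui (Suc i) l (taui i l (taui (Suc i) l v)))
      + scale (kappa l) (taui i l (prepend i l (taui (Suc i) l (taui i l (taui (Suc i) l v)))))"
proof -
  have "taui (Suc i) l (taui i l (taui (Suc i) l (opB i l v))) = taui (Suc i) l (opC i l (taui i l (tau (Suc i) l v)))"
    by (simp add: opC_tau commute_opC homog3_tpow v)
  also have "\<dots> = opB i l (taui (Suc i) l (taui i l (tau (Suc i) l v))) - scale (kappa l) (opC i l (taui i l (tau (Suc i) l v)))"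
    by (simp only: taui_tau[of l "Suc i" "opC i l _"] tau_opC)
  finally have 1: "taui (Suc i) l (taui i l (taui (Suc i) l (opB i l v))) =
     opB i l (taui (Suc i) l (taui i l (tau (Suc i) l v))) - scale (kappa l) (opC i l (taui i l (tau (Suc i) l v)))" .
  have "taui (Suc i) l (taui i l (taui (Suc i) l (prepend i l (taui i l v)))) =
     opC i l (tau (Suc i) l (tau i l (taui (Suc i) l (taui i l v))))"
    by (simp add: tpow_prepend_far taui_prepend opC_tau)
  also have "tau (Suc i) l (tau i l (taui (Suc i) l (taui i l v))) = taui i l (tau (Suc i) l v)"
    using braid_mixed(1)[OF br[OF homog3_tpow(1)[OF v]], of l "flip l"] by simp
  finally have 2: "taui (Suc i) l (taui i l (taui (Suc i) l (prepend i l (taui i l v)))) = opC i l (taui i l (tau (Suc i) l v))" .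
  have "taui i l (prepend i l (taui (Suc i) l (taui i l (taui (Suc i) l v)))) = opB i l (taui (Suc i) l (taui i l v))"
    by (simp add: taui_prepend omega v)
  moreover have "taui (Suc i) l (taui i l (tau (Suc i) l v)) = tau i l (taui (Suc i) l (taui i l v))"
    using braid_mixed(1)[OF br[OF v], of "flip l"] by simp
  moreover have "tau i l (taui (Suc i) l (taui i l v)) =
      taui (Suc i) l (taui i l (taui (Suc i) l v)) + scale (kappa l) (taui (Suc i) l (taui i l v))"
    by (simp only: omega v tau_taui[of l i "taui (Suc i) l (taui i l v)"])
  ultimately show ?thesis
    by (simp only: 1 2 B_lin) simp
qed

text \<open>
  The counterpart for \<open>b'\<close>, needed for the exchange rule for \<open>c b'\<close> on \<open>a' v\<close>. The form
  \<open>\<omega> = \<sigma>\<^sub>1' \<sigma>\<^sub>2' \<sigma>\<^sub>1'\<close> lets \<open>\<sigma>\<^sub>1' b' = a' \<sigma>\<^sub>1\<close> apply first; it holds at \<open>b' v\<close>, although this has \<open>k + 1\<close> letters, by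
  \<open>braid_second\<close>.
\<close>
lemma omega_B_flip:
  assumes v: "homog3 i k v" and m: "m = flip l"
  shows "taui (Suc i) l (taui i l (taui (Suc i) l (opB i m v)))
    = opB i m (taui (Suc i) l (taui i l (taui (Suc i) l v)))
      - scale (kappa l) (prepend i m (tau i l (taui (Suc i) l (taui i l (taui (Suc i) l v)))))
      + scale (kappa l) (opB i m (taui i l (taui (Suc i) l v)))
      - scale (kappa l * kappa l) (prepend i m (taui (Suc i) l v))"
proof -
  have "taui (Suc i) l (taui i l (taui (Suc i) l (opB i m v))) = taui i l (taui (Suc i) l (taui i l (opB i m v)))"
    using braid_tpow[OF braid_second[OF v, of m], of "flip l"] by simp
  also have "taui i l (opB i m v) = prepend i m (tau i l v)"
    using tau_B[of m i v] by (simp add: m)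
  also have "taui i l (taui (Suc i) l (prepend i m (tau i l v))) = taui i l (prepend i m (taui (Suc i) l (tau i l v)))"
    by (simp add: tpow_prepend_far)
  also have "\<dots> = opB i m (taui i l (taui (Suc i) l (tau i l v))) - scale (kappa l) (prepend i m (taui (Suc i) l (tau i l v)))"
    using tau_prepend[of m i "taui (Suc i) l (tau i l v)"] by (simp add: m lin_simps)
  also have "taui (Suc i) l (tau i l v) = taui (Suc i) l (taui i l v) + scale (kappa l) (taui (Suc i) l v)"
    by (simp only: tau_taui[of l i v] tpow_lin)
  finally show ?thesis
    by (simp add: omega v lin_simps)
qed

text \<open>
  The overlap of the sorting rules: three letters on strands \<open>i + 2\<close>, \<open>i + 1\<close>, \<open>i\<close> can be sorted starting
  with the first two or with the last two. Up to the symmetry there are four patterns of letters.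
\<close>
lemma exchange_first:
  assumes v: "homog3 i k v"
  shows "opC i l (opB i m (prepend i p v)) = opB i m (opC i l (prepend i p v)) +
      (if l = m then 0 else scale (kappa l) (opB i m (opB i l (taui (Suc i) l (prepend i p v)))))"
proof -
  note [simp] = lin_simps commute_opC homog3_tpow v B_prepend opC_prepend D tpow_prepend_far
  consider "m = l" "p = l" | "m = l" "p = flip l" | "m = flip l" "p = l" | "m = flip l" "p = flip l"
    by (metis neq_flip)
  then show ?thesis
  proof cases
    case 1
    then show ?thesis by simp
  next
    case 2
    let ?c = "\<lambda>x. scale (kappa l) (prepend i p (prepend i l x))"
    have "opC i l (opB i m (prepend i p v)) = prepend i p (opB i l (opC i l v)) + ?c (opC i l (taui i l v)) +
       ?c (taui (Suc i) l (taui i l (taui (Suc i) l (opB i l v)))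
      + scale (kappa l) (taui (Suc i) l (taui i l (taui (Suc i) l (prepend i l (taui i l v))))))"
      using 2 by (simp add: algebra_simps)
    also have "\<dots> = opB i m (opC i l (prepend i p v))"
      unfolding omega_B[OF v] using 2 by (simp add: algebra_simps)
    finally show ?thesis using 2 by simp
  next
    case 3
    then show ?thesis
      using omega[OF homog3_tpow(1)[OF v, of l], of l]
      by (simp add: tau_B taui_prepend algebra_simps)
  next
    case 4
    have "opC i l (opB i m (prepend i p v)) = prepend i p (opC i l (opB i m v))
       + scale (kappa l) (prepend i p (prepend i l (taui (Suc i) l (taui i l (taui (Suc i) l (opB i m v))))))"
      using 4 by simp
    then show ?thesis
      unfolding omega_B_flip[OF v 4(1)] using 4 by (simp add: algebra_simps)
  qed
qed

end

text \<open>
  If strand \<open>i\<close> is empty, the exchange rule is the one for strands \<open>i + 1\<close> and \<open>i + 2\<close>; if strands \<open>i\<close> and \<open>i + 1\<close> are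
  empty, \<open>c\<close> prepends to a strand that \<open>T\<^sub>i\<close> does not touch; if all three are empty, the braid
  relation is the one of the Hecke algebra.
\<close>
lemma three_strands:
  "(\<forall>v. homog3 i n v \<longrightarrow> opT i (opT (Suc i) (opT i v)) = opT (Suc i) (opT i (opT (Suc i) v))) \<and>
   (\<forall>l v. homog3 i n v \<longrightarrow> opT i (opC i l v) = opC i l (opT i v)) \<and>
   (\<forall>l m v. homog3 i n v \<longrightarrow> opC i l (opB i m v) = opB i m (opC i l v) +
      (if l = m then 0 else scale (kappa l) (opB i m (opB i l (taui (Suc i) l v)))))"
proof (induct n)
  have D_vacant: "opC i l (opB i m v) = opB i m (opC i l v) +
      (if l = m then 0 else scale (kappa l) (opB i m (opB i l (taui (Suc i) l v))))" if "vacant i v" for l m v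
    using that by (simp add: B_vacant opC_vacant vacant_prepend vacant_B vacant_tpow B_prepend)
  have commute_vacant: "opT i (opC i l v) = opC i l (opT i v)" if "vacant i v" "vacant (Suc i) v" for l v
  proof -
    have "vacant i (opT i v)" "vacant (Suc i) (opT i v)"
      using that by (simp_all add: T_vacant vacant_hecke_op)
    then show ?thesis
      using that by (simp add: opC_vacant B_vacant T_prepend_far)
  qed
  have br_none: "opT i (opT (Suc i) (opT i v)) = opT (Suc i) (opT i (opT (Suc i) v))"
    if "vacant i v" "vacant (Suc i) v" "vacant (Suc (Suc i)) v" for v
    using that by (simp add: T_vacant vacant_hecke_op hecke_op_braid)
  {
    case 0
    have e: "vacant i (ket b)" "vacant (Suc i) (ket b)" "vacant (Suc (Suc i)) (ket b)" if "deg3 i b = 0" for b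
      using that by (simp_all add: vacant_ket deg3_def)
    show ?case
    proof (intro conjI allI impI)
      fix v assume "homog3 i 0 v"
      then show "opT i (opT (Suc i) (opT i v)) = opT (Suc i) (opT i (opT (Suc i) v))"
        by (induct rule: supported_induct) (use e br_none in \<open>auto simp: lin_simps\<close>)
    next
      fix l v assume "homog3 i 0 v"
      then show "opT i (opC i l v) = opC i l (opT i v)"
        by (induct rule: supported_induct) (use e commute_vacant in \<open>auto simp: lin_simps\<close>)
    next
      fix l m v assume "homog3 i 0 v"
      then show "opC i l (opB i m v) = opB i m (opC i l v) +
        (if l = m then 0 else scale (kappa l) (opB i m (opB i l (taui (Suc i) l v))))"
      proof (induct rule: supported_induct)
        case (ket b)
        then show ?case using e by (intro D_vacant)
      qed (auto simp: lin_simps algebra_simps)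
    qed
  next
    case (Suc k)
    note IH = Suc[THEN conjunct1, rule_format] Suc[THEN conjunct2, THEN conjunct1, rule_format]
      Suc[THEN conjunct2, THEN conjunct2, rule_format]
    show ?case
    proof (intro conjI allI impI)
      fix v assume "homog3 i (Suc k) v"
      then show "opT i (opT (Suc i) (opT i v)) = opT (Suc i) (opT i (opT (Suc i) v))"
      proof (induct rule: supported_induct)
        case (ket b)
        show ?case
        proof (cases b rule: ket_cases3[where i = i])
          case (first m b')
          show ?thesis unfolding first(1)
            by (rule braid_first[OF IH]) (use ket first in auto)
        next
          case (second m b')
          show ?thesis unfolding second(1)
            by (rule braid_second[OF IH]) (use ket second in auto)
        next
          case (third m b')
          show ?thesis unfolding third(1)
            by (rule braid_third[OF IH]) (use ket third in auto)
        next
          case none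
          then show ?thesis using ket by simp
        qed
      qed (auto simp: lin_simps)
    next
      fix l v assume "homog3 i (Suc k) v"
      then show "opT i (opC i l v) = opC i l (opT i v)"
      proof (induct rule: supported_induct)
        case (ket b)
        show ?case
        proof (cases b rule: ket_cases3[where i = i])
          case (first m b')
          show ?thesis unfolding first(1)
            by (rule commute_opC_first[OF IH]) (use ket first in auto)
        next
          case (second m b')
          show ?thesis unfolding second(1)
            by (rule commute_opC_second[OF IH]) (use ket second in auto)
        next
          case (third m b')
          show ?thesis by (intro commute_vacant) (simp_all add: vacant_ket third(3,4))
        next
          case none
          then show ?thesis by (intro commute_vacant) (simp_all add: vacant_ket)
        qed
      qed (auto simp: lin_simps)
    next
      fix l m v assume "homog3 i (Suc k) v"
      then show "opC i l (opB i m v) = opB i m (opC i l v) +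
        (if l = m then 0 else scale (kappa l) (opB i m (opB i l (taui (Suc i) l v))))"
      proof (induct rule: supported_induct)
        case (ket b)
        show ?case
        proof (cases "fst b i")
          case Nil
          then show ?thesis by (intro D_vacant) (simp add: vacant_ket)
        next
          case (Cons p q)
          then obtain p b' where first: "ket b = prepend i p (ket b')" "deg3 i b = Suc (deg3 i b')"
            by (cases b rule: ket_cases3[where i = i]) auto
          show ?thesis unfolding first(1)
            by (rule exchange_first[OF IH]) (use ket first in auto)
        qed
      qed (auto simp: lin_simps algebra_simps)
    qed
  }
qed

lemma T_braid: "opT i (opT (Suc i) (opT i v)) = opT (Suc i) (opT i (opT (Suc i) v))"
proof (induct v rule: ket_induct)
  case (ket b)
  show ?case using three_strands[of i "deg3 i b"] by simp
qed (simp_all add: lin_simps)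

section \<open>The representation of the algebra\<close>

primrec opZ :: "nat \<Rightarrow> letter \<Rightarrow> std_space \<Rightarrow> std_space" where
  "opZ 0 l = prepend 0 l"
| "opZ (Suc i) l = (\<lambda>v. taui i l (opZ i l (taui i l v)))"

lemma linop_opZ [simp]: "linop (opZ i l)"
  by (induct i) (simp_all add: linop_def lin_simps)
lemmas Z_lin [lin_simps] = linop_simps[OF linop_opZ]

lemma T_Z_less: "j < i \<Longrightarrow> opT i (opZ j l v) = opZ j l (opT i v)"
proof (induct j arbitrary: v)
  case 0
  then show ?case by (simp add: T_prepend_far)
next
  case (Suc j)
  have "opT i (tpow m (opT j) v) = tpow m (opT j) (opT i v)" for m v
    by (rule commute_tpow) (use Suc(2) in \<open>auto intro: T_T_far\<close>)
  then show ?case using Suc by simp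
qed

lemma tpow_Z_less: "j < i \<Longrightarrow> tpow m (opT i) (opZ j l v) = opZ j l (tpow m (opT i) v)"
  by (cases m) (simp_all add: T_Z_less lin_simps)

text \<open>
  For \<open>j = i + 2\<close>, the braid relation turns \<open>T\<^sub>i\<close> into \<open>T\<^sub>i\<^sub>+\<^sub>1\<close>, which passes \<open>Z\<^sub>i\<close> and is turned back
  on the other side.
\<close>
lemma T_Z_greater: "i + 1 < j \<Longrightarrow> opT i (opZ j l v) = opZ j l (opT i v)"
proof (induct j arbitrary: v)
  case (Suc j)
  show ?case
  proof (cases "j = Suc i")
    case True
    note br = braid_mixed[where i = i and j = "Suc i" and l = "flip l", OF T_braid]
    have "tau i l (opZ (Suc j) l v) =
        tau i l (taui (Suc i) l (taui i l (opZ i l (taui i l (taui (Suc i) l v)))))"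
      by (simp add: True)
    also have "\<dots> = taui (Suc i) l (taui i l (tau (Suc i) l (opZ i l (taui i l (taui (Suc i) l v)))))"
      using br(1) by simp
    also have "\<dots> = taui (Suc i) l (taui i l (opZ i l (tau (Suc i) l (taui i l (taui (Suc i) l v)))))"
      by (simp add: tpow_Z_less)
    also have "\<dots> = taui (Suc i) l (taui i l (opZ i l (taui i l (taui (Suc i) l (tau i l v)))))"
      using br(2) by simp
    also have "\<dots> = opZ (Suc j) l (tau i l v)"
      by (simp add: True)
    finally show ?thesis
      by (simp only: T_tpow[of i _ l] Z_lin)
  next
    case False
    have "opT i (tpow m (opT j) v) = tpow m (opT j) (opT i v)" for m v
      by (rule commute_tpow) (use Suc(2) False in \<open>auto intro: T_T_far\<close>)
    then show ?thesis using Suc False by simp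
  qed
qed simp

lemma T_Z: "j \<noteq> i \<Longrightarrow> j \<noteq> i + 1 \<Longrightarrow> opT i (opZ j l v) = opZ j l (opT i v)"
  using T_Z_less[of j i] T_Z_greater[of i j] by (cases "j < i") auto

lemma tpow_Z: "j \<noteq> i \<Longrightarrow> j \<noteq> i + 1 \<Longrightarrow> tpow m (opT i) (opZ j l v) = opZ j l (tpow m (opT i) v)"
  by (cases m) (simp_all add: T_Z lin_simps)

lemma Z_1: "opZ (Suc 0) l v = opB 0 l v"
  using taui_prepend[of l 0 "taui 0 l v"] by simp

lemma Z_Z_less: "i < j \<Longrightarrow> opZ i l (opZ j l v) = opZ j l (opZ i l v)"
proof (induct i arbitrary: v)
  case 0
  then show ?case
  proof (induct j arbitrary: v)
    case (Suc j)
    show ?case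
    proof (cases "j = 0")
      case True
      then show ?thesis by (simp add: Z_1 B_prepend del: opZ.simps(2))
    next
      case False
      then have "taui j l (opZ 0 l x) = opZ 0 l (taui j l x)" for x
        by (intro tpow_Z) auto
      moreover have "opZ j l (prepend 0 l x) = prepend 0 l (opZ j l x)" for x
        using Suc False by simp
      ultimately show ?thesis by simp
    qed
  qed simp
next
  case (Suc i)
  have "taui i l (opZ j l x) = opZ j l (taui i l x)" for x
    using Suc(2) by (intro tpow_Z) auto
  with Suc show ?case by simp
qed

lemma Z_Z: "opZ i l (opZ j l v) = opZ j l (opZ i l v)"
  using Z_Z_less[of i j l v] Z_Z_less[of j i l v] by (cases i j rule: linorder_cases) auto

text \<open>This is the exchange rule on strands \<open>0\<close> and \<open>1\<close> for \<open>X\<close> past \<open>Y\<close>, multiplied by \<open>T\<^sub>0\<close> from the right.\<close>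
lemma Z_Y_T_X: "opZ 0 LY (opT 0 (opZ 0 LX v)) = opZ (Suc 0) LX (opZ 0 LY (opT 0 v))"
proof -
  have "opT 0 (prepend 0 LX v) = opB 0 LX (opT 0 v) + scale h (prepend 0 LX v)"
    using tau_prepend[of LX 0 v] by simp
  moreover have "taui 0 LX (opT 0 v) = v"
    using taui_inv[of LX 0 v] by simp
  then have "opZ (Suc 0) LX (prepend 0 LY (opT 0 v)) = prepend 0 LY (opB 0 LX (opT 0 v) + scale h (prepend 0 LX v))"
    by (simp add: Z_1 B_prepend lin_simps del: opZ.simps(2) tpow.simps flip.simps)
  ultimately show ?thesis by (simp del: opZ.simps(2) tpow.simps)
qed

primrec gen_op :: "gen \<Rightarrow> std_space \<Rightarrow> std_space" where
  "gen_op (GT i) = opT i"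
| "gen_op (GTinv i) = tpow LY (opT i)"
| "gen_op (GX i) = opZ i LX"
| "gen_op (GY i) = opZ i LY"

lemma linop_gen_op [simp]: "linop (gen_op g)"
  by (cases g) (simp_all del: tpow.simps)
lemmas gen_op_lin [lin_simps] = linop_simps[OF linop_gen_op]

definition word_op :: "gword \<Rightarrow> std_space \<Rightarrow> std_space" where
  "word_op w = foldr gen_op (gletters w)"

lemma linop_word_op [simp]: "linop (word_op w)"
proof -
  have "linop (foldr gen_op gs)" for gs
    by (induct gs) (simp_all add: linop_def lin_simps)
  then show ?thesis by (simp add: word_op_def)
qed
lemmas word_op_lin [lin_simps] = linop_simps[OF linop_word_op]

lemma word_op_plus: "word_op (v + w) m = word_op v (word_op w m)"
  by (simp add: word_op_def plus_gword_def)

definition falg_op :: "falg \<Rightarrow> std_space \<Rightarrow> std_space" where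
  "falg_op x m = lin (\<lambda>w. word_op w m) x"

lemma falg_op_ket: "falg_op (ket w) m = word_op w m"
  by (simp add: falg_op_def)

lemma falg_op_lin_left: "falg_op (x + y) m = falg_op x m + falg_op y m" "falg_op (scale c x) m = scale c (falg_op x m)"
  "falg_op (x - y) m = falg_op x m - falg_op y m" "falg_op 0 m = 0"
  by (simp_all add: falg_op_def linop_simps[OF linop_lin])

lemma linop_falg_op [simp]: "linop (falg_op x)"
  unfolding linop_def
proof safe
  show "falg_op x (m + m') = falg_op x m + falg_op x m'" for m m'
    by (induct x rule: ket_induct) (simp_all add: falg_op_ket falg_op_lin_left lin_simps)
  show "falg_op x (scale c m) = scale c (falg_op x m)" for c m
    by (induct x rule: ket_induct) (simp_all add: falg_op_ket falg_op_lin_left lin_simps mult.commute)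
qed
lemmas falg_op_lin [lin_simps] = linop_simps[OF linop_falg_op]

lemma scale_conv_times: "scale c x = fconst c * x"
  by (simp add: scale_def fconst_def mult_map_scale_conv_mult)

lemma scale_times: "scale c x * y = scale c (x * y)" for x :: falg
  by (simp add: scale_conv_times mult.assoc)

lemma times_scale: "x * scale c y = scale c (x * y)" for x :: falg
proof -
  have "x * fconst c = fconst c * x"
  proof (induct x rule: ket_induct)
    case (ket b)
    show ?case by (simp add: fconst_def mult_single)
  next
    case (scale d x)
    then show ?case by (simp add: scale_times) (simp add: scale_conv_times[of c] scale_conv_times[of d] flip: mult.assoc fconst_simps(2) mult.commute[of c d])
  qed (simp_all add: distrib_left distrib_right)
  then show ?thesis by (simp add: scale_conv_times flip: mult.assoc)
qed

lemma falg_op_times: "falg_op (x * y) m = falg_op x (falg_op y m)"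
proof (induct x rule: ket_induct)
  case (ket v)
  show ?case
    by (induct y rule: ket_induct)
      (simp_all add: mult_single falg_op_ket word_op_plus falg_op_lin_left times_scale distrib_left lin_simps)
qed (simp_all add: falg_op_lin_left scale_times distrib_right)

lemma falg_op_fgen: "falg_op (fgen g) m = gen_op g m"
  by (simp add: fgen_def falg_op_ket word_op_def)

lemma falg_op_one: "falg_op 1 m = m"
  using falg_op_ket[of 0 m] unfolding single_one by (simp add: word_op_def zero_gword_def)

lemma falg_op_fconst: "falg_op (fconst c) m = scale c m"
  using falg_op_lin_left(2)[of c 1 m] by (simp add: falg_op_one scale_conv_times)

lemma falg_op_rel: "daha_rel x y \<Longrightarrow> falg_op x m = falg_op y m"
proof (induct rule: daha_rel.induct)
  case (T_Tinv i)
  show ?case using tau_inv[of LX i m] by (simp add: falg_op_times falg_op_fgen falg_op_one)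
next
  case (Tinv_T i)
  show ?case using taui_inv[of LX i m] by (simp add: falg_op_times falg_op_fgen falg_op_one)
next
  case (T_T i j)
  then show ?case using T_T_far[of i j m] by (simp add: falg_op_times falg_op_fgen)
next
  case (braid i)
  show ?case by (simp add: falg_op_times falg_op_fgen T_braid)
next
  case (quadratic i)
  show ?case by (simp add: falg_op_lin_left falg_op_fgen falg_op_fconst)
next
  case (T_X_T i)
  show ?case by (simp add: falg_op_times falg_op_fgen)
next
  case (T_X j i)
  then show ?case by (simp add: falg_op_times falg_op_fgen T_Z)
next
  case (X_X i j)
  show ?case by (simp only: falg_op_times falg_op_fgen gen_op.simps Z_Z[of i])
next
  case (T_Y_T i)
  show ?case by (simp add: falg_op_times falg_op_fgen)
next
  case (T_Y j i)
  then show ?case by (simp add: falg_op_times falg_op_fgen T_Z)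
next
  case (Y_Y i j)
  show ?case by (simp only: falg_op_times falg_op_fgen gen_op.simps Z_Z[of i])
next
  case Y_T_X
  show ?case using Z_Y_T_X[of m] by (simp only: falg_op_times falg_op_fgen gen_op.simps One_nat_def)
qed

lemma falg_op_cong: "daha_cong x y \<Longrightarrow> falg_op x m = falg_op y m"
  by (induct arbitrary: m rule: daha_cong.induct) (simp_all add: falg_op_rel falg_op_lin_left falg_op_times)

lift_definition daha_op :: "daha \<Rightarrow> std_space \<Rightarrow> std_space" is falg_op
  by (rule ext) (rule falg_op_cong)

lemma daha_op_simps:
  "daha_op (a * b) m = daha_op a (daha_op b m)" "daha_op 1 m = m" "daha_op (a + b) m = daha_op a m + daha_op b m"
  "daha_op (daha_scale c a) m = scale c (daha_op a m)" "daha_op (dT i) m = opT i m"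
  "daha_op (dX i) m = opZ i LX m" "daha_op (dY i) m = opZ i LY m" "daha_op 0 m = 0"
  by (transfer; simp add: falg_op_times falg_op_one falg_op_lin_left falg_op_fconst falg_op_fgen)+

lemma daha_op_letter: "daha_op (letter_val i l) m = opZ i l m"
  by (cases l) (simp_all add: daha_op_simps)

text \<open>
  The reason why standard words are sorted by strand: a letter that meets only empty strands on its left is
  simply prepended.
\<close>
lemma Z_vacant: "(\<And>j. j < i \<Longrightarrow> vacant j v) \<Longrightarrow> opZ i l v = prepend i l v"
proof (induct i arbitrary: v)
  case (Suc i)
  have "opZ i l (taui i l v) = prepend i l (taui i l v)"
    using Suc(2) by (intro Suc(1) vacant_tpow) auto
  then show ?case
    using Suc(2)[of i] by (simp add: taui_prepend B_vacant)
qed simp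

lemma daha_op_letters:
  assumes "\<And>j. j \<le> i \<Longrightarrow> u j = []"
  shows "daha_op (prod_list (map (letter_val i) ls)) (ket (u, f)) = ket (u(i := ls), f)"
proof (induct ls)
  case Nil
  then show ?case using assms[of i] by (simp add: daha_op_simps fun_upd_idem)
next
  case (Cons l ls)
  have "opZ i l (ket (u(i := ls), f)) = prepend i l (ket (u(i := ls), f))"
    using assms by (intro Z_vacant) (simp add: vacant_ket)
  also have "\<dots> = ket (u(i := l # ls), f)"
    by (simp only: prepend_ket fun_upd_same fun_upd_upd)
  finally show ?case
    by (simp only: list.map prod_list.Cons daha_op_simps daha_op_letter Cons)
qed

lemma daha_op_words:
  assumes "\<And>i. k \<le> i \<Longrightarrow> u i = []"
  shows "daha_op (prod_list (map (\<lambda>i. prod_list (map (letter_val i) (u i))) [0..<k])) (ket (\<lambda>_. [], f))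
    = ket (u, f)"
proof -
  have "daha_op (prod_list (map (\<lambda>i. prod_list (map (letter_val i) (u i))) [j..<k])) (ket (\<lambda>_. [], f))
    = ket (\<lambda>i. if i < j then [] else u i, f)" if "j \<le> k" for j
    using that
  proof (induct j rule: inc_induct)
    case base
    have "(\<lambda>i. if i < k then [] else u i) = (\<lambda>_. [])" using assms by auto
    then show ?case by (simp add: daha_op_simps)
  next
    case (step j)
    have "(\<lambda>i. if i < Suc j then [] else u i)(j := u j) = (\<lambda>i. if i < j then [] else u i)"
      by (auto simp: less_Suc_eq)
    with step show ?case
      by (simp add: upt_conv_Cons daha_op_simps daha_op_letters)
  qed
  from this[of 0] show ?thesis by simp
qed

section \<open>Standard words span\<close>

lemma daha_scale_times: "daha_scale c a * b = daha_scale c (a * b)"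
  by transfer (simp add: mult.assoc daha_cong.refl)

lemma daha_times_scale: "a * daha_scale c b = daha_scale c (a * b)"
proof transfer
  fix c and a b :: falg
  show "daha_cong (a * (fconst c * b)) (fconst c * (a * b))"
    using times_scale[of a c b] by (simp add: scale_conv_times daha_cong.refl)
qed

lemma span_image:
  assumes "x \<in> daha.span S" "\<And>y. y \<in> S \<Longrightarrow> a * y * b \<in> daha.span S'"
  shows "a * x * b \<in> daha.span S'"
  using assms(1)
proof (induct rule: daha.span_induct)
  case base
  show ?case
    unfolding daha.subspace_def
    by (auto simp: distrib_left distrib_right daha_scale_times daha_times_scale
        intro: daha.span_add daha.span_scale daha.span_zero)
qed (use assms(2) in auto)

lift_definition dTi :: "nat \<Rightarrow> daha" is fTi .

lemma dT_dTi: "dT i * dTi i = 1" by transfer (rule daha_cong.rel[OF daha_rel.T_Tinv])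
lemma dTi_dT: "dTi i * dT i = 1" by transfer (rule daha_cong.rel[OF daha_rel.Tinv_T])
lemma dT_far: "i + 1 < j \<or> j + 1 < i \<Longrightarrow> dT i * dT j = dT j * dT i"
  by transfer (rule daha_cong.rel[OF daha_rel.T_T])
lemma dT_braid: "dT i * dT (Suc i) * dT i = dT (Suc i) * dT i * dT (Suc i)"
  using daha_cong.rel[OF daha_rel.braid[of i]] by transfer simp
lemma dT_quadratic: "dT i - dTi i = daha_scale h 1"
  using daha_cong.rel[OF daha_rel.quadratic[of i]] by transfer simp
lemma dX_Suc: "dTi i * dX i * dTi i = dX (Suc i)"
  using daha_cong.rel[OF daha_rel.T_X_T[of i]] by transfer simp
lemma dY_Suc: "dT i * dY i * dT i = dY (Suc i)"
  using daha_cong.rel[OF daha_rel.T_Y_T[of i]] by transfer simp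
lemma dT_dX: "j \<noteq> i \<Longrightarrow> j \<noteq> i + 1 \<Longrightarrow> dT i * dX j = dX j * dT i"
  by transfer (rule daha_cong.rel[OF daha_rel.T_X])
lemma dT_dY: "j \<noteq> i \<Longrightarrow> j \<noteq> i + 1 \<Longrightarrow> dT i * dY j = dY j * dT i"
  by transfer (rule daha_cong.rel[OF daha_rel.T_Y])
lemma dX_dX: "dX i * dX j = dX j * dX i"
  by transfer (rule daha_cong.rel[OF daha_rel.X_X])
lemma dY_dY: "dY i * dY j = dY j * dY i"
  by transfer (rule daha_cong.rel[OF daha_rel.Y_Y])
lemma dY_dT_dX_0: "dY 0 * dT 0 * dX 0 = dX (Suc 0) * dY 0 * dT 0"
  using daha_cong.rel[OF daha_rel.Y_T_X] by transfer simp

lemma dT_dTi_assoc: "dT i * (dTi i * x) = x" "dTi i * (dT i * x) = x"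
  by (simp_all add: dT_dTi dTi_dT flip: mult.assoc)

lemma dTi_eq: "dTi i = dT i - daha_scale h 1"
  using dT_quadratic[of i] by (simp add: algebra_simps)

lemma dT_dT: "dT i * dT i = 1 + daha_scale h (dT i)"
  using dT_dTi[of i] by (simp add: dTi_eq right_diff_distrib daha_times_scale algebra_simps)

lemma dTi_commute: "dT i * x = x * dT i \<Longrightarrow> dTi i * x = x * dTi i"
  by (metis dT_dTi dTi_dT mult.assoc mult.left_neutral mult.right_neutral)

primrec dtau :: "letter \<Rightarrow> nat \<Rightarrow> daha" where
  "dtau LX i = dT i"
| "dtau LY i = dTi i"

lemma dtau_flip: "dtau l i * (dtau (flip l) i * x) = x" "dtau (flip l) i * (dtau l i * x) = x"
  "dtau l i * dtau (flip l) i = 1" "dtau (flip l) i * dtau l i = 1"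
  by (cases l; simp add: dT_dTi_assoc dT_dTi dTi_dT)+

lemma letter_val_Suc: "letter_val (Suc i) l = dtau (flip l) i * letter_val i l * dtau (flip l) i"
  by (cases l) (simp_all add: dX_Suc dY_Suc)

lemma dT_letter: "j \<noteq> i \<Longrightarrow> j \<noteq> Suc i \<Longrightarrow> dT i * letter_val j l = letter_val j l * dT i"
  by (cases l) (simp_all add: dT_dX dT_dY)

text \<open>
  The defining relations contain this only for \<open>i = 0\<close>. Conjugating with \<open>T\<^sub>i T\<^sub>i\<^sub>+\<^sub>1\<^sup>-\<^sup>1\<close> takes both
  sides for \<open>i\<close> to those for \<open>i + 1\<close>, by \<open>T\<^sub>i T\<^sub>i\<^sub>+\<^sub>1 T\<^sub>i\<^sup>-\<^sup>1 = T\<^sub>i\<^sub>+\<^sub>1\<^sup>-\<^sup>1 T\<^sub>i T\<^sub>i\<^sub>+\<^sub>1\<close>.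
\<close>
lemma dY_dT_dX: "dY i * dT i * dX i = dX (Suc i) * dY i * dT i"
proof (induct i)
  case 0
  show ?case by (rule dY_dT_dX_0)
next
  case (Suc i)
  let ?t = "dT i" and ?s = "dT (Suc i)" and ?t' = "dTi i" and ?s' = "dTi (Suc i)"
  have b1: "?t * (?s * ?t') = ?s' * (?t * ?s)"
    using dT_braid[of i] by (metis dT_dTi dT_dTi_assoc(2) mult.assoc mult.right_neutral)
  have sY: "?s' * dY i = dY i * ?s'" by (rule dTi_commute) (simp add: dT_dY)
  have sX: "?s * dX i = dX i * ?s" by (simp add: dT_dX)
  have tX: "?t * dX (Suc (Suc i)) = dX (Suc (Suc i)) * ?t" by (simp add: dT_dX)
  have "dY (Suc i) * ?s * dX (Suc i) = ?t * dY i * (?t * (?s * ?t')) * dX i * ?t'"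
    by (simp add: dX_Suc[symmetric] dY_Suc[symmetric] mult.assoc)
  also have "\<dots> = ?t * (dY i * ?s') * ?t * (?s * dX i) * ?t'"
    by (simp add: b1 mult.assoc)
  also have "\<dots> = ?t * ?s' * (dY i * ?t * dX i) * ?s * ?t'"
    by (simp add: sX sY[symmetric] mult.assoc)
  also have "\<dots> = ?t * ?s' * dX (Suc i) * dY i * (?t * (?s * ?t'))"
    unfolding Suc by (simp add: mult.assoc)
  also have "\<dots> = ?t * (?s' * dX (Suc i) * ?s') * dY i * ?t * ?s"
    using sY by (simp add: b1 mult.assoc)
  also have "\<dots> = ?t * dX (Suc (Suc i)) * dY i * ?t * ?s"
    by (simp add: dX_Suc)
  also have "\<dots> = dX (Suc (Suc i)) * (?t * dY i * ?t) * ?s"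
    by (simp add: tX mult.assoc)
  finally show ?case by (simp add: dY_Suc)
qed

lemma letter_exchange: "letter_val (Suc i) l * letter_val i m = letter_val i m * letter_val (Suc i) l +
   (if l = m then 0 else daha_scale (kappa l) (letter_val i m * letter_val i l * dtau (flip l) i))"
proof (cases "l = m")
  case True
  then show ?thesis by (cases m) (simp_all add: dX_dX dY_dY)
next
  case False
  show ?thesis
  proof (cases l)
    case LX
    have "dX (Suc i) * dY i = dX (Suc i) * dY i * dT i * dTi i"
      by (simp add: mult.assoc dT_dTi)
    also have "\<dots> = dY i * dT i * (dX i * dTi i)"
      unfolding dY_dT_dX[symmetric] by (simp only: mult.assoc)
    also have "\<dots> = dY i * (dTi i + daha_scale h 1) * (dX i * dTi i)"
      by (simp add: dTi_eq)
    also have "\<dots> = dY i * (dTi i * dX i * dTi i) + daha_scale h (dY i * dX i * dTi i)"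
      by (simp add: distrib_left distrib_right daha_times_scale daha_scale_times mult.assoc)
    finally show ?thesis using LX False by (cases m) (simp_all add: dX_Suc)
  next
    case LY
    have "dY (Suc i) * dX i = dT i * (dY i * dT i * dX i)"
      by (simp add: dY_Suc[symmetric] mult.assoc)
    also have "\<dots> = dX i * (dTi i * dY i * dT i)"
      unfolding dY_dT_dX dX_Suc[symmetric] by (simp add: mult.assoc dT_dTi_assoc)
    also have "\<dots> = dX i * ((dT i - daha_scale h 1) * dY i * dT i)"
      by (simp add: dTi_eq)
    also have "\<dots> = dX i * (dT i * dY i * dT i) - daha_scale h (dX i * dY i * dT i)"
      by (simp add: right_diff_distrib left_diff_distrib daha_times_scale daha_scale_times mult.assoc)
    finally show ?thesis using LY False by (cases m) (simp_all add: dY_Suc daha.scale_minus_left)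
  qed
qed

abbreviation letters :: "nat \<Rightarrow> letter list \<Rightarrow> daha" where
  "letters i p \<equiv> prod_list (map (letter_val i) p)"

text \<open>
  Sorted words on two strands with \<open>n\<close> letters. Counting letters makes the induction hypothesis of
  \<open>strand_span_left\<close> apply to all linear combinations of shorter words.
\<close>
definition strand_span :: "nat \<Rightarrow> nat \<Rightarrow> daha set" where
  "strand_span i n = daha.span {letters i p * letters (Suc i) q * s | p q s. length p + length q = n \<and> s \<in> {1, dT i}}"

lemma strand_span_gen: "length p + length q = n \<Longrightarrow> s \<in> {1, dT i} \<Longrightarrow> letters i p * letters (Suc i) q * s \<in> strand_span i n"
  unfolding strand_span_def by (rule daha.span_base) blast

lemma strand_span_closed: "x \<in> strand_span i n \<Longrightarrow> y \<in> strand_span i n \<Longrightarrow> x + y \<in> strand_span i n"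
  "x \<in> strand_span i n \<Longrightarrow> y \<in> strand_span i n \<Longrightarrow> x - y \<in> strand_span i n"
  "x \<in> strand_span i n \<Longrightarrow> daha_scale c x \<in> strand_span i n" "0 \<in> strand_span i n"
  unfolding strand_span_def by (auto intro: daha.span_add daha.span_diff daha.span_scale daha.span_zero)

lemma strand_span_right: "x \<in> strand_span i n \<Longrightarrow> x * dT i \<in> strand_span i n"
proof -
  assume x: "x \<in> strand_span i n"
  have "1 * x * dT i \<in> strand_span i n"
    unfolding strand_span_def
  proof (rule span_image[OF x[unfolded strand_span_def]], fold strand_span_def)
    fix y assume "y \<in> {letters i p * letters (Suc i) q * s |p q s. length p + length q = n \<and> s \<in> {1, dT i}}"
    then obtain p q s where y: "y = letters i p * letters (Suc i) q * s" "length p + length q = n" "s \<in> {1, dT i}"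
      by blast
    have *: "letters i p * letters (Suc i) q * 1 \<in> strand_span i n" "letters i p * letters (Suc i) q * dT i \<in> strand_span i n"
      using strand_span_gen[OF y(2), of 1 i] strand_span_gen[OF y(2), of "dT i" i] by simp_all
    have "letters i p * letters (Suc i) q * (dT i * dT i) \<in> strand_span i n"
      unfolding dT_dT distrib_left daha_times_scale using * by (intro strand_span_closed)
    then show "1 * y * dT i \<in> strand_span i n"
      using * y(3) by (auto simp: y(1) mult.assoc)
  qed
  then show ?thesis by simp
qed

lemma strand_span_prepend: "x \<in> strand_span i n \<Longrightarrow> letter_val i l * x \<in> strand_span i (Suc n)"
proof -
  assume x: "x \<in> strand_span i n"
  have "letter_val i l * x * 1 \<in> strand_span i (Suc n)"
    unfolding strand_span_def
  proof (rule span_image[OF x[unfolded strand_span_def]], fold strand_span_def)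
    fix y assume "y \<in> {letters i p * letters (Suc i) q * s |p q s. length p + length q = n \<and> s \<in> {1, dT i}}"
    then obtain p q s where y: "y = letters i p * letters (Suc i) q * s" "length p + length q = n" "s \<in> {1, dT i}"
      by blast
    have "letters i (l # p) * letters (Suc i) q * s \<in> strand_span i (Suc n)"
      using y by (intro strand_span_gen) auto
    then show "letter_val i l * y * 1 \<in> strand_span i (Suc n)"
      by (simp add: y(1) mult.assoc)
  qed
  then show ?thesis by simp
qed

lemma strand_span_left_gen:
  assumes g: "\<And>p q. length p + length q = n \<Longrightarrow> a * (letters i p * letters (Suc i) q) \<in> strand_span i k"
    and x: "x \<in> strand_span i n"
  shows "a * x \<in> strand_span i k"
proof -
  have "a * x * 1 \<in> strand_span i k"
    unfolding strand_span_def
  proof (rule span_image[OF x[unfolded strand_span_def]], fold strand_span_def)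
    fix y assume "y \<in> {letters i p * letters (Suc i) q * s |p q s. length p + length q = n \<and> s \<in> {1, dT i}}"
    then obtain p q s where y: "y = letters i p * letters (Suc i) q * s" "length p + length q = n" "s \<in> {1, dT i}"
      by blast
    have "a * (letters i p * letters (Suc i) q) * s \<in> strand_span i k"
      using y(3) g[OF y(2)] strand_span_right[OF g[OF y(2)]] by auto
    then show "a * y * 1 \<in> strand_span i k"
      by (simp add: y(1) mult.assoc)
  qed
  then show ?thesis by simp
qed

text \<open>
  To move \<open>T\<^sub>i\<close> past a first letter on strand \<open>i\<close>, one needs to sort a letter on strand \<open>i + 1\<close> into a shorter word;
  to sort such a letter, one needs to move \<open>T\<^sub>i\<close> into a shorter word.
\<close>
lemma strand_span_left:
  "(\<forall>x\<in>strand_span i n. dT i * x \<in> strand_span i n) \<and> (\<forall>l. \<forall>x\<in>strand_span i n. letter_val (Suc i) l * x \<in> strand_span i (Suc n))"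
proof (induct n rule: less_induct)
  case (less n)
  have opT: "dT i * x \<in> strand_span i k" if "x \<in> strand_span i k" "k < n" for x k
    using less that by blast
  have tau: "dtau l i * x \<in> strand_span i k" if "x \<in> strand_span i k" "k < n" for x k l
    using opT[OF that] that(1)
    by (cases l) (auto simp: dTi_eq left_diff_distrib daha_scale_times intro!: strand_span_closed)
  have b: "letter_val (Suc i) l * x \<in> strand_span i (Suc k)" if "x \<in> strand_span i k" "k < n" for x k l
    using less that by blast
  have gen: "letters i p * letters (Suc i) q \<in> strand_span i k" if "length p + length q = k" for p q k
    using strand_span_gen[OF that, of 1 i] by simp
  have "dT i * (letters i p * letters (Suc i) q) \<in> strand_span i n" if len: "length p + length q = n" for p q
  proof (cases p)
    case (Cons m p')
    have v: "letters i p' * letters (Suc i) q \<in> strand_span i (n - 1)" "n - 1 < n" "Suc (n - 1) = n"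
      using len Cons by (auto intro: gen)
    have "dtau (flip m) i * letter_val i m = letter_val (Suc i) m * dtau m i"
      by (simp add: letter_val_Suc mult.assoc dtau_flip)
    then have "dtau (flip m) i * (letters i p * letters (Suc i) q) =
        letter_val (Suc i) m * (dtau m i * (letters i p' * letters (Suc i) q))"
      by (simp add: Cons flip: mult.assoc)
    also have "\<dots> \<in> strand_span i n"
      using b[OF tau[OF v(1,2)] v(2)] v(3) by simp
    finally have *: "dtau (flip m) i * (letters i p * letters (Suc i) q) \<in> strand_span i n" .
    show ?thesis
    proof (cases m)
      case LX
      with * strand_span_closed(1)[OF * strand_span_closed(3)[OF gen[OF len], of h]] show ?thesis
        by (simp add: dTi_eq left_diff_distrib daha_scale_times)
    qed (use * in simp)
  next
    case Nil
    show ?thesis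
    proof (cases q)
      case Nil
      then show ?thesis using \<open>p = []\<close> len strand_span_gen[of "[]" "[]" n "dT i" i] by simp
    next
      case (Cons m q')
      have v: "letters i [] * letters (Suc i) q' \<in> strand_span i (n - 1)" "n - 1 < n" "Suc (n - 1) = n"
        using len Cons Nil by (auto intro!: gen simp del: list.map)
      have "dtau m i * letter_val (Suc i) m = letter_val i m * dtau (flip m) i"
        by (simp add: letter_val_Suc mult.assoc dtau_flip)
      then have "dtau m i * (letters i p * letters (Suc i) q) =
          letter_val i m * (dtau (flip m) i * (letters i [] * letters (Suc i) q'))"
        by (simp add: Cons Nil flip: mult.assoc)
      also have "\<dots> \<in> strand_span i n"
        using strand_span_prepend[OF tau[OF v(1,2)]] v(3) by simp
      finally have *: "dtau m i * (letters i p * letters (Suc i) q) \<in> strand_span i n" .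
      show ?thesis
      proof (cases m)
        case LY
        with * strand_span_closed(1)[OF * strand_span_closed(3)[OF gen[OF len], of h]] show ?thesis
          by (simp add: dTi_eq left_diff_distrib daha_scale_times)
      qed (use * in simp)
    qed
  qed
  moreover have "letter_val (Suc i) l * (letters i p * letters (Suc i) q) \<in> strand_span i (Suc n)"
    if len: "length p + length q = n" for p q l
  proof (cases p)
    case Nil
    then show ?thesis
      using gen[of "[]" "l # q" "Suc n"] len by simp
  next
    case (Cons m p')
    let ?v = "letters i p' * letters (Suc i) q"
    have v: "?v \<in> strand_span i (n - 1)" "n - 1 < n" "Suc (n - 1) = n"
      using len Cons by (auto intro: gen)
    have "letter_val (Suc i) l * (letters i p * letters (Suc i) q) = (letter_val (Suc i) l * letter_val i m) * ?v"
      by (simp add: Cons mult.assoc)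
    also have "\<dots> = letter_val i m * (letter_val (Suc i) l * ?v) +
        daha_scale (if l = m then 0 else kappa l) (letter_val i m * (letter_val i l * (dtau (flip l) i * ?v)))"
      unfolding letter_exchange by (simp add: distrib_right daha_scale_times mult.assoc)
    also have "\<dots> \<in> strand_span i (Suc n)"
      using strand_span_prepend[OF b[OF v(1,2)]] strand_span_prepend[OF strand_span_prepend[OF tau[OF v(1,2)]]] v(3)
      by (intro strand_span_closed) simp_all
    finally show ?thesis .
  qed
  ultimately show ?case
    using strand_span_left_gen by blast
qed

lemma dT_strand_span_words:
  "dT i * (letters i p * letters (Suc i) q) \<in>
    daha.span {letters i p * letters (Suc i) q * s | p q s. s \<in> {1, dT i}}"
proof -
  let ?n = "length p + length q"
  have "letters i p * letters (Suc i) q \<in> strand_span i ?n" using strand_span_gen[of p q ?n 1 i] by simp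
  then have "dT i * (letters i p * letters (Suc i) q) \<in> strand_span i ?n" using strand_span_left by blast
  also have "strand_span i ?n \<subseteq> daha.span {letters i p * letters (Suc i) q * s | p q s. s \<in> {1, dT i}}"
    unfolding strand_span_def by (rule daha.span_mono) blast
  finally show ?thesis .
qed

lemma T_perm_reduced:
  assumes "reduced js"
  shows "T_perm (perm_of js) = prod_list (map dT js)"
proof -
  let ?js = "SOME js'. reduced_expr js' (perm_of js)"
  have "reduced_expr ?js (perm_of js)"
    by (rule someI[of _ js]) (use assms in \<open>simp add: reduced_def\<close>)
  then have p: "perm_of ?js = perm_of js" and r: "reduced ?js"
    by (simp_all add: reduced_def reduced_expr_def)
  show ?thesis unfolding T_perm_def
    by (rule matsumoto[OF _ _ r assms p]) (simp_all add: dT_far dT_braid)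
qed

lemma permutes_red:
  assumes "w permutes {..<k}"
  obtains js where "reduced js" "perm_of js = w"
  using reduced_expr_ex[OF assms] by (auto simp: reduced_def reduced_expr_def)

lemma T_perm_left:
  assumes "w permutes {..<k}" "Suc i < k"
  shows "dT i * T_perm w \<in> daha.span (T_perm ` {w. w permutes {..<k}})" (is "_ \<in> daha.span ?S")
proof -
  obtain js where js: "reduced js" "perm_of js = w" using permutes_red[OF assms(1)] .
  have perm: "perm_of (i # js) permutes {..<k}"
    unfolding perm_of_Cons js(2)
    by (rule permutes_compose[OF assms(1) permutes_swap_id]) (use assms(2) in auto)
  have ne: "inv (perm_of js) i \<noteq> inv (perm_of js) (Suc i)"
    by (simp add: inj_eq[OF bij_is_inj[OF bij_imp_bij_inv[OF bij_perm_of]]])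
  show ?thesis
  proof (cases "inv (perm_of js) i < inv (perm_of js) (Suc i)")
    case True
    have "dT i * T_perm w = T_perm (perm_of (i # js))"
      using T_perm_reduced[OF reduced_Cons[OF js(1) True]] T_perm_reduced[OF js(1)] js(2) by simp
    also have "\<dots> \<in> daha.span ?S" using perm by (intro daha.span_base) blast
    finally show ?thesis .
  next
    case False
    with ne have "inv (perm_of js) (Suc i) < inv (perm_of js) i" by linarith
    then obtain js' where js': "reduced (i # js')" "perm_of (i # js') = perm_of js"
      using reduced_descent[OF js(1)] by metis
    have w: "T_perm w = dT i * T_perm (perm_of js')"
      using T_perm_reduced[OF js'(1)] T_perm_reduced[OF reduced_tail[OF js'(1)]] js'(2) js(2) by simp
    have "perm_of (i # js) = perm_of js'"
      using perm_of_cong[OF js'(2), of i] by (simp only: perm_of_cancel)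
    with perm have p: "perm_of js' permutes {..<k}" by simp
    have "dT i * T_perm w = T_perm (perm_of js') + daha_scale h (T_perm w)"
      unfolding w mult.assoc[symmetric] dT_dT by (simp add: distrib_right daha_scale_times)
    also have "\<dots> \<in> daha.span ?S"
      using p assms(1) by (intro daha.span_add daha.span_scale daha.span_base) blast+
    finally show ?thesis .
  qed
qed

lemma dT_prod_words:
  assumes "\<And>j. j \<in> set js \<Longrightarrow> j \<noteq> i \<and> j \<noteq> Suc i"
  shows "dT i * prod_list (map (\<lambda>j. letters j (u j)) js) = prod_list (map (\<lambda>j. letters j (u j)) js) * dT i"
proof -
  have commute: "dT i * prod_list xs = prod_list xs * dT i" if "\<And>x. x \<in> set xs \<Longrightarrow> dT i * x = x * dT i" for xs
    using that
  proof (induct xs)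
    case (Cons x xs)
    have "dT i * (x * prod_list xs) = x * (dT i * prod_list xs)"
      using Cons(2)[of x] by (simp flip: mult.assoc)
    with Cons show ?case by (simp add: mult.assoc)
  qed simp
  have "dT i * letters j (u j) = letters j (u j) * dT i" if "j \<in> set js" for j
    by (rule commute) (use assms[OF that] in \<open>auto intro: dT_letter\<close>)
  then show ?thesis
    by (intro commute) auto
qed

lemma std_word_split:
  assumes "Suc i < k"
  shows "std_word k (u(i := p, Suc i := q), w) =
    prod_list (map (\<lambda>j. letters j (u j)) [0..<i]) * (letters i p * letters (Suc i) q)
      * (prod_list (map (\<lambda>j. letters j (u j)) [Suc (Suc i)..<k]) * T_perm w)"
proof -
  have "[0..<k] = [0..<i] @ [i..<k]"
    using assms upt_add_eq_append[of 0 i "k - i"] by simp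
  also have "[i..<k] = i # Suc i # [Suc (Suc i)..<k]"
    using assms by (simp add: upt_conv_Cons)
  finally have k: "[0..<k] = [0..<i] @ i # Suc i # [Suc (Suc i)..<k]" .
  have "map (\<lambda>j. letters j ((u(i := p, Suc i := q)) j)) [0..<i] = map (\<lambda>j. letters j (u j)) [0..<i]"
    "map (\<lambda>j. letters j ((u(i := p, Suc i := q)) j)) [Suc (Suc i)..<k] = map (\<lambda>j. letters j (u j)) [Suc (Suc i)..<k]"
    by (auto intro!: map_cong)
  note * = this
  show ?thesis
    unfolding std_word_def k prod.case map_append list.map prod_list.append prod_list.Cons *
    by (simp add: mult.assoc)
qed

lemma std_word_in: "1 \<le> k \<Longrightarrow> x \<in> formal_words k \<Longrightarrow> std_word k x \<in> all_std_words"
  unfolding all_std_words_def std_words_def by auto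

text \<open>
  Between the words on the strands below \<open>i\<close>, which commute with \<open>T\<^sub>i\<close>, and those above \<open>i + 1\<close>, which commute with the
  \<open>T\<^sub>i\<close> left over, only the two strands matter. To have these strands and \<open>s\<^sub>i\<close> available, the word
  is first viewed as one on at least \<open>i + 2\<close> strands.
\<close>
lemma dT_std_word:
  assumes "x \<in> formal_words k"
  shows "dT i * std_word k x \<in> daha.span all_std_words"
proof -
  define n where "n = max k (Suc (Suc i))"
  have n: "k \<le> n" "Suc i < n" by (auto simp: n_def)
  have x: "x \<in> formal_words n" "std_word n x = std_word k x"
    using formal_words_mono[OF n(1)] std_word_stable[OF assms n(1)] assms by auto
  obtain u w where uw: "x = (u, w)" by (cases x)
  have w: "w permutes {..<n}" and u: "\<And>j. j \<ge> n \<Longrightarrow> u j = []"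
    using x(1) by (auto simp: uw formal_words_def)
  let ?P = "prod_list (map (\<lambda>j. letters j (u j)) [0..<i])"
  let ?Q = "prod_list (map (\<lambda>j. letters j (u j)) [Suc (Suc i)..<n])"
  have P: "dT i * ?P = ?P * dT i" and Q: "dT i * ?Q = ?Q * dT i"
    by (rule dT_prod_words; auto)+
  have std: "?P * (letters i p * letters (Suc i) q) * (?Q * T_perm v) \<in> all_std_words"
    if "v permutes {..<n}" for p q v
  proof -
    have "(u(i := p, Suc i := q), v) \<in> formal_words n"
      using that u n(2) by (auto simp: formal_words_def)
    then show ?thesis
      unfolding std_word_split[OF n(2), symmetric] using n(2) by (intro std_word_in) auto
  qed
  have span: "?P * y * (?Q * T_perm w) \<in> daha.span all_std_words"
    if y: "y \<in> {letters i p * letters (Suc i) q * s | p q s. s \<in> {1, dT i}}" for y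
  proof -
    from y obtain p q s where y: "y = letters i p * letters (Suc i) q * s" and s: "s \<in> {1, dT i}" by blast
    have "s * T_perm w \<in> daha.span (T_perm ` {w. w permutes {..<n}})"
      using s T_perm_left[OF w n(2)] daha.span_base[of "T_perm w" "T_perm ` {w. w permutes {..<n}}"] w by auto
    then have "(?P * (letters i p * letters (Suc i) q) * ?Q) * (s * T_perm w) * 1 \<in> daha.span all_std_words"
    proof (rule span_image)
      fix z assume "z \<in> T_perm ` {w. w permutes {..<n}}"
      then obtain v where "z = T_perm v" "v permutes {..<n}" by auto
      then show "?P * (letters i p * letters (Suc i) q) * ?Q * z * 1 \<in> daha.span all_std_words"
        using std[of v p q] by (simp add: mult.assoc daha.span_base)
    qed
    moreover have "s * ?Q = ?Q * s" using s Q by auto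
    then have "?P * y * (?Q * T_perm w) = ?P * (letters i p * letters (Suc i) q) * ?Q * (s * T_perm w) * 1"
      unfolding y by (simp add: mult.assoc) (simp flip: mult.assoc)
    ultimately show ?thesis by simp
  qed
  have "u(i := u i, Suc i := u (Suc i)) = u" by simp
  then have "dT i * std_word n x = ?P * (dT i * (letters i (u i) * letters (Suc i) (u (Suc i)))) * (?Q * T_perm w)"
    using std_word_split[OF n(2), of u "u i" "u (Suc i)" w] P by (simp add: uw flip: mult.assoc)
  also have "\<dots> \<in> daha.span all_std_words"
    by (rule span_image[OF dT_strand_span_words span])
  finally show ?thesis by (simp add: x(2))
qed

lemma letter_std_word:
  assumes "1 \<le> k" "x \<in> formal_words k"
  shows "letter_val 0 l * std_word k x \<in> daha.span all_std_words"
proof -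
  obtain u w where uw: "x = (u, w)" by (cases x)
  have k: "[0..<k] = 0 # [Suc 0..<k]" using assms(1) by (simp add: upt_conv_Cons)
  have "map (\<lambda>j. letters j ((u(0 := l # u 0)) j)) [Suc 0..<k] = map (\<lambda>j. letters j (u j)) [Suc 0..<k]"
    by (auto intro!: map_cong)
  note * = this
  have "letter_val 0 l * std_word k x = std_word k (u(0 := l # u 0), w)"
    unfolding std_word_def uw k prod.case list.map prod_list.Cons * by (simp add: mult.assoc)
  moreover have "(u(0 := l # u 0), w) \<in> formal_words k"
    using assms by (auto simp: formal_words_def uw)
  ultimately show ?thesis
    using assms(1) by (simp add: std_word_in daha.span_base)
qed

text \<open>
  The elements with this property form a subalgebra, so it suffices to find \<open>T\<^sub>i\<close>, \<open>X\<^sub>0\<close> and \<open>Y\<^sub>0\<close> in it.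
\<close>
definition preserves_span :: "daha \<Rightarrow> bool" where
  "preserves_span a \<longleftrightarrow> (\<forall>x\<in>daha.span all_std_words. a * x \<in> daha.span all_std_words)"

lemma preserves_spanI:
  assumes "\<And>k x. 1 \<le> k \<Longrightarrow> x \<in> formal_words k \<Longrightarrow> a * std_word k x \<in> daha.span all_std_words"
  shows "preserves_span a"
  unfolding preserves_span_def
proof
  fix x assume x: "x \<in> daha.span all_std_words"
  have "a * x * 1 \<in> daha.span all_std_words"
  proof (rule span_image[OF x])
    fix y assume "y \<in> all_std_words"
    then obtain k z where "1 \<le> k" "z \<in> formal_words k" "y = std_word k z"
      by (auto simp: all_std_words_def std_words_def)
    then show "a * y * 1 \<in> daha.span all_std_words" using assms by simp
  qed
  then show "a * x \<in> daha.span all_std_words" by simp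
qed

lemma preserves_span_closed: "preserves_span a \<Longrightarrow> preserves_span b \<Longrightarrow> preserves_span (a * b)" "preserves_span a \<Longrightarrow> preserves_span b \<Longrightarrow> preserves_span (a + b)"
  "preserves_span a \<Longrightarrow> preserves_span b \<Longrightarrow> preserves_span (a - b)" "preserves_span a \<Longrightarrow> preserves_span (daha_scale c a)" "preserves_span 1" "preserves_span 0"
  by (auto simp: preserves_span_def mult.assoc distrib_right left_diff_distrib daha_scale_times
      intro: daha.span_add daha.span_diff daha.span_scale daha.span_zero)

lemma preserves_span_dT: "preserves_span (dT i)"
  by (rule preserves_spanI) (rule dT_std_word)

lemma preserves_span_dtau: "preserves_span (dtau l i)"
proof (cases l)
  case LY
  have "preserves_span (dT i - daha_scale h 1)" by (intro preserves_span_closed preserves_span_dT)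
  with LY show ?thesis by (simp add: dTi_eq)
qed (simp add: preserves_span_dT)

lemma preserves_span_letter: "preserves_span (letter_val i l)"
  by (induct i) (auto simp: letter_val_Suc intro: preserves_spanI letter_std_word preserves_span_closed preserves_span_dtau)

lemma preserves_span_gen: "preserves_span (abs_daha (fgen g))"
proof (cases g)
  case (GT i)
  then show ?thesis using preserves_span_dT[of i] by (simp add: dT.abs_eq)
next
  case (GTinv i)
  then show ?thesis using preserves_span_dtau[of LY i] by (simp add: dTi.abs_eq)
next
  case (GX i)
  then show ?thesis using preserves_span_letter[of i LX] by (simp add: dX.abs_eq)
next
  case (GY i)
  then show ?thesis using preserves_span_letter[of i LY] by (simp add: dY.abs_eq)
qed

lemma preserves_span_word: "preserves_span (abs_daha (ket (GWord gs)))"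
proof (induct gs)
  case Nil
  have "abs_daha (ket (GWord [])) = 1"
    by (simp add: one_daha_def flip: zero_gword_def)
  then show ?case by (simp add: preserves_span_closed)
next
  case (Cons g gs)
  have "ket (GWord (g # gs)) = fgen g * ket (GWord gs)"
    by (simp add: fgen_def mult_single plus_gword_def)
  then have "abs_daha (ket (GWord (g # gs))) = abs_daha (fgen g) * abs_daha (ket (GWord gs))"
    by (simp add: times_daha.abs_eq)
  then show ?case using Cons preserves_span_gen by (simp add: preserves_span_closed)
qed

lemma preserves_span_all: "preserves_span a"
proof -
  have "preserves_span (abs_daha x)" for x
  proof (induct x rule: ket_induct)
    case (ket b)
    show ?case using preserves_span_word[of "gletters b"] by simp
  next
    case zero
    show ?case by (simp add: preserves_span_closed flip: zero_daha_def)
  next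
    case (add x y)
    then show ?case by (simp add: preserves_span_closed flip: plus_daha.abs_eq)
  next
    case (scale c x)
    have "abs_daha (scale c x) = daha_scale c (abs_daha x)"
      by (simp add: scale_conv_times daha_scale.abs_eq)
    with scale show ?case by (simp add: preserves_span_closed)
  qed
  then show ?thesis using abs_daha_surj[of a] by auto
qed

lemma one_std_word: "std_word 1 (\<lambda>_. [], id) = 1"
proof -
  have "reduced []" by (rule reducedI) simp
  then show ?thesis
    using T_perm_reduced[of "[]"] by (simp add: std_word_def perm_of_Nil)
qed

lemma span_std_words: "daha.span all_std_words = UNIV"
proof -
  have "(\<lambda>_. [], id) \<in> formal_words 1"
    by (auto simp: formal_words_def permutes_id)
  then have "std_word 1 (\<lambda>_. [], id) \<in> all_std_words"
    by (intro std_word_in) simp_all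
  then have "1 \<in> daha.span all_std_words"
    unfolding one_std_word by (rule daha.span_base)
  then have "a \<in> daha.span all_std_words" for a
    using preserves_span_all[of a] by (auto simp: preserves_span_def dest: bspec[of _ _ 1])
  then show ?thesis by blast
qed

section \<open>Standard words are independent\<close>

lift_definition id_arrangement :: arrangement is id by simp

abbreviation vac :: std_space where "vac \<equiv> ket (\<lambda>_. [], id_arrangement)"

text \<open>
  Along a reduced expression every step goes up, so that the regular representation never produces its
  second term.
\<close>
lemma daha_op_reduced:
  "reduced js \<Longrightarrow> daha_op (prod_list (map dT js)) vac = ket (\<lambda>_. [], Arrangement (inv (perm_of js)))"
proof (induct js)
  case Nil
  show ?case by (simp only: list.map prod_list.Nil daha_op_simps perm_of_Nil inv_id id_arrangement_def)
next
  case (Cons j js)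
  let ?f = "Arrangement (inv (perm_of js))"
  have inj: "inj (inv (perm_of js))" for js
    by (rule bij_is_inj[OF bij_imp_bij_inv[OF bij_perm_of]])
  have position: "position (Arrangement (inv (perm_of js))) = inv (perm_of js)" for js
    using inj by (simp add: Arrangement_inverse)
  have "swap_at j ?f = Arrangement (inv (perm_of (j # js)))"
    by (rule arrangement_eqI) (simp only: position_swap_at position inv_perm_of_Cons_apply)
  moreover have "\<not> position ?f (Suc j) < position ?f j"
    using reduced_ascent[OF Cons(2)] by (simp add: position)
  ultimately have "hecke_op j (ket (\<lambda>_. [], ?f)) = ket (\<lambda>_. [], Arrangement (inv (perm_of (j # js))))"
    by (simp add: hecke_op_ket)
  then show ?case
    using Cons(1)[OF reduced_tail[OF Cons(2)]] by (simp add: daha_op_simps T_vacant vacant_ket)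
qed

lemma daha_op_std_word:
  assumes "(u, w) \<in> formal_words k"
  shows "daha_op (std_word k (u, w)) vac = ket (u, Arrangement (inv w))"
proof -
  have w: "w permutes {..<k}" and u: "\<And>i. k \<le> i \<Longrightarrow> u i = []"
    using assms by (auto simp: formal_words_def)
  obtain js where js: "reduced js" "perm_of js = w" using permutes_red[OF w] .
  have "daha_op (T_perm w) vac = ket (\<lambda>_. [], Arrangement (inv w))"
    using T_perm_reduced[OF js(1)] daha_op_reduced[OF js(1)] js(2) by simp
  then show ?thesis
    using u by (simp add: std_word_def daha_op_simps daha_op_words)
qed

definition standard_index :: "(nat \<Rightarrow> letter list) \<times> (nat \<Rightarrow> nat) \<Rightarrow> index" where
  "standard_index = (\<lambda>(u, w). (u, Arrangement (inv w)))"

lemma inj_on_standard_index: "inj_on standard_index (formal_words k)"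
proof (rule inj_onI)
  fix x y assume *: "x \<in> formal_words k" "y \<in> formal_words k" "standard_index x = standard_index y"
  obtain u w v z where xy: "x = (u, w)" "y = (v, z)" by (cases x, cases y)
  have wz: "w permutes {..<k}" "z permutes {..<k}"
    using * by (auto simp: formal_words_def xy)
  have "Arrangement (inv w) = Arrangement (inv z)"
    using * by (simp add: standard_index_def xy)
  moreover have "inj (inv w)" "inj (inv z)"
    by (rule permutes_inj[OF permutes_inv[OF wz(1)]], rule permutes_inj[OF permutes_inv[OF wz(2)]])
  ultimately have "inv w = inv z"
    using Arrangement_inject by blast
  then have "w = z" using wz by (metis permutes_inv_inv)
  then show "x = y" using * by (simp add: standard_index_def xy)
qed

lemma daha_op_standard_index: "x \<in> formal_words k \<Longrightarrow> daha_op (std_word k x) vac = ket (standard_index x)"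
  by (cases x) (simp add: standard_index_def daha_op_std_word)

theorem theorem7p10:
  shows "(\<forall>k. inj_on (std_word k) (formal_words k)) \<and>
    daha.independent all_std_words \<and> daha.span all_std_words = UNIV"
proof (intro conjI allI)
  fix k
  show "inj_on (std_word k) (formal_words k)"
    by (rule inj_onI) (metis daha_op_standard_index inj_on_standard_index inj_onD ket_eq_iff)
next
  have ex: "\<exists>b. daha_op v vac = ket b" if "v \<in> all_std_words" for v
    using that by (auto simp: all_std_words_def std_words_def daha_op_standard_index)
  have inj: "v = v'" if v: "v \<in> all_std_words" "v' \<in> all_std_words" "daha_op v vac = daha_op v' vac" for v v'
  proof -
    from v obtain k x l y where x: "v = std_word k x" "x \<in> formal_words k"
      and y: "v' = std_word l y" "y \<in> formal_words l"
      by (auto simp: all_std_words_def std_words_def)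
    have m: "x \<in> formal_words (max k l)" "y \<in> formal_words (max k l)"
      using x y formal_words_mono[of k "max k l"] formal_words_mono[of l "max k l"] by auto
    have "standard_index x = standard_index y"
      using v(3) x y by (simp add: daha_op_standard_index)
    then have "x = y" using inj_onD[OF inj_on_standard_index] m by blast
    then show "v = v'"
      using x y std_word_stable[of x k "max k l"] std_word_stable[of x l "max k l"] by simp
  qed
  show "daha.independent all_std_words"
  proof
    assume "daha.dependent all_std_words"
    then obtain S c where S: "finite S" "S \<subseteq> all_std_words" "(\<Sum>v\<in>S. daha_scale (c v) v) = 0"
      and "\<exists>v\<in>S. c v \<noteq> 0"
      unfolding daha.dependent_explicit by blast
    then obtain v where v: "v \<in> S" "c v \<noteq> 0" by blast
    obtain b where b: "daha_op v vac = ket b" using ex S(2) v(1) by blast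
    have "daha_op (\<Sum>v\<in>S. daha_scale (c v) v) vac = (\<Sum>v\<in>S. scale (c v) (daha_op v vac))"
      using S(1) by (induct S) (simp_all add: daha_op_simps)
    then have "0 = lookup (\<Sum>v\<in>S. scale (c v) (daha_op v vac)) b"
      by (simp add: S(3) daha_op_simps)
    also have "\<dots> = (\<Sum>x\<in>S. if x = v then c v else 0)"
      unfolding lookup_sum
    proof (rule sum.cong)
      fix x assume x: "x \<in> S"
      then obtain b' where b': "daha_op x vac = ket b'" using ex S(2) by blast
      have "b' = b \<longleftrightarrow> x = v" using inj[of x v] S(2) x v(1) b b' by auto
      then show "lookup (scale (c x) (daha_op x vac)) b = (if x = v then c v else 0)"
        by (auto simp: b' lookup_single)
    qed simp
    also have "\<dots> = c v" using S(1) v(1) by simp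
    finally show False using v(2) by simp
  qed
next
  show "daha.span all_std_words = UNIV" by (rule span_std_words)
qed

end
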